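(* Consider the problem $\min_{x\in\mathcal X}f(x)=\sum_{j=1}^mf_j(x)$, $f_j(x)=\mathbb E[F_j(x;\xi_j)]$, with $\mathcal X=\{x\in\mathbb R^d:Bx-b\le0,\ Cx-c\le0\}$, where $B\in\mathbb R^{d_1\times d}$, $b\in\mathbb R^{d_1}$, $C\in\mathbb R^{d_2\times d}$, $c\in\mathbb R^{d_2}$, and the distributed dual averaging algorithm with regularizer $\psi(x)=\frac12\|x\|^2$ described in the context. Let $x^*\in\mathcal X^*$ be the limit of $\{\bar x_k\}$, with $Bx^*=b$ and $Cx^*<c$. Suppose: 1. (Objective) For every $j$ and every $\xi_j$, $F_j(\cdot;\xi_j)$ is differentiable and convex on $\mathcal X$, and $|F_j(x;\xi_j)-F_j(y;\xi_j)|\le L_{0,j}(\xi_j)\|x-y\|$ for all $x,y\in\mathcal X$, with $L_{0,j}$ measurable and $\mathbb E[L_{0,j}^p(\xi_j)]<\infty$ for some $p\ge2$. There is $L>0$ with $\|\nabla f_j(x)-\nabla f_j(y)\|\le L\|x-y\|$ for all $x,y\in\mathcal X$ and all $j$. There are $c_0,\epsilon\in(0,\infty)$ with $\|\nabla f(x)-\nabla f(x^* )-\nabla^2f(x^* )(x-x^* )\|\le c_0\|x-x^*\|^2$ for all $x\in\mathcal X$ with $\|x-x^*\|\le\epsilon$. There is $\mu>0$ with $x^T\nabla^2f(x^* )x\ge\mu\|x\|^2$ for all $x$ in the critical tangent cone $\mathcal T_{\mathcal X}(x^* )=\{x:Bx=0\}$. 2. (Constraint qualification) $-\nabla f(x^*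 )\in\operatorname{ri}\mathcal N_{\mathcal X}(x^* )$, where $\mathcal N_{\mathcal X}(x^* )=\{B^T\lambda:\lambda\in\mathbb R^{d_1}_+\}$ is the normal cone and $\operatorname{ri}$ the relative interior. 3. (Weight matrices) $A_k$, $k\ge1$, are i.i.d. random doubly stochastic matrices with nonnegative entries; the spectral norm $\rho$ of $\mathbb E\big[A_k^T(I_m-\frac{\mathbf 1\mathbf 1^T}m)A_k\big]$ satisfies $\rho<1$; and $A_k$ is independent of $\mathcal F_k$ for every $k$. 4. (Step-size) $\alpha_k=a/k^\alpha$ with $\alpha\in(\frac23,1)$, $a>0$. 5. (Sampling) For all $i,j$: $\xi_{j,1},\xi_{j,2},\dots$ is an i.i.d. sample of $\xi_j$; for $i\ne j$, $\xi_{i,k}$ and $\xi_{j,k}$ are conditionally independent given $\mathcal F_k'=\sigma(\mathcal F_k\cup\sigma(A_k))$; and $\xi_{j,k}$ is conditionally independent of $A_k$ given $\mathcal F_k$. Then with probability one there exists some (random) $K<\infty$ such that for all $k\ge K$, $$B\bar x_k=b,\qquad C\bar x_k<c.$$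
   Context: Setting. $m$ agents; for each $1\le j\le m$, $\xi_j$ is a random vector on a probability space $(\Omega,\mathcal F,\mathbb P)$, $F_j(x;\xi_j)$ is real-valued, $f_j(x)=\mathbb E[F_j(x;\xi_j)]$, $f=\sum_jf_j$, and $\mathcal X^*$ is the set of minimizers of $f$ over $\mathcal X$. $\nabla F_j$ is the gradient in $x$. $\mathbf 1\in\mathbb R^m$ is the all-ones vector; $\|\cdot\|$ is the Euclidean norm of vectors and the spectral norm of matrices; vector inequalities are componentwise. Algorithm (with $\psi(x)=\frac12\|x\|^2$). Let $\mathrm Q(z)=\arg\max_{x\in\mathcal X}\{\langle z,x\rangle-\frac12\|x\|^2\}$. Each agent $j$ starts from $z_{j,0}\in\mathbb R^d$ (possibly random). For $k=1,2,\dots$, $$x_{j,k}=\mathrm Q(z_{j,k-1}),\qquad z_{j,k}=\sum_{i=1}^m[A_k]_{ji}z_{i,k-1}-\alpha_k\nabla F_j(x_{j,k};\xi_{j,k}),$$ where $\xi_{j,k}$ is a sample of $\xi_j$ drawn at step $k$, $A_k\in\mathbb R^{m\times m}$ is the random weight matrix and $\alpha_k$ the step-size. Averages: $\bar z_k=\frac1m\sum_jz_{j,k}$, $\bar x_{k+1}=\mathrm Q(\bar z_k)$, $k\ge0$. Filtration. $\mathcal F_1=\sigma\{z_{j,0}:1\le j\le m\}$, $\mathcal F_k=\sigma\{z_{j,0},\xi_{j,t},A_t:1\le j\le m,\,1\le t\le k-1\}$. The point $x^*$. Under the listed hypotheses $\bar x_k$ converges almost surely to a point of $\mathcal X^*$,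 denoted $x^*$; the second-order condition makes $x^*$ the unique minimizer of $f$ over $\mathcal X$. $Bx\le b$ collects the constraints active at $x^*$ and $Cx\le c$ the inactive ones. Conventions. The sample $\xi_{j,k}$ is drawn afresh, i.e. it is distributed as $\xi_j$ and independent of $\mathcal F_k$, so that $\mathbb E[\nabla F_j(x_{j,k};\xi_{j,k})-\nabla f_j(x_{j,k})\mid\mathcal F_k]=0$. The Lipschitz hypothesis is understood to include $\|\nabla F_j(x;\xi_j)\|\le L_{0,j}(\xi_j)$ and $\nabla f_j(x)=\mathbb E[\nabla F_j(x;\xi_j)]$ for $x\in\mathcal X$. *)

theory Defs
  imports "HOL-Probability.Probability"
begin

section \<open>Gradients\<close>

definition gradient :: "('a::real_inner \<Rightarrow> real) \<Rightarrow> 'a \<Rightarrow> 'a" where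
  "gradient f x = (THE g. GDERIV f x :> g)"

lemma gradient_eqI:
  assumes "GDERIV f x :> g"
  shows "gradient f x = g"
proof -
  have "h = g" if "GDERIV f x :> h" for h
  proof -
    have "(\<lambda>v. v \<bullet> h) = (\<lambda>v. v \<bullet> g)"
      using has_derivative_unique that assms unfolding gderiv_def by blast
    then show ?thesis by (metis vector_eq_ldot)
  qed
  with assms show ?thesis unfolding gradient_def by blast
qed

section \<open>The constrained stochastic problem\<close>

text \<open>The order \<open>x < y\<close> of the library on vectors means \<open>x \<le> y \<and> \<not> y \<le> x\<close>, which is not the
  componentwise strict inequality; vector inequalities are therefore spelled out by components.\<close>

definition feasible_set ::
  "real^'d^'p \<Rightarrow> real^'p \<Rightarrow> real^'d^'q \<Rightarrow> real^'q \<Rightarrow> (real^'d) set" where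
  "feasible_set B b C c =
     {x. (\<forall>i. (B *v x - b) $ i \<le> 0) \<and> (\<forall>i. (C *v x - c) $ i \<le> 0)}"

text \<open>Normal cone and critical tangent cone at a point where exactly the rows of \<open>B\<close> are active.\<close>

definition active_normal_cone :: "real^'d^'p \<Rightarrow> (real^'d) set" where
  "active_normal_cone B = {transpose B *v l | l. \<forall>i. 0 \<le> l $ i}"

definition critical_tangent_cone :: "real^'d^'p \<Rightarrow> (real^'d) set" where
  "critical_tangent_cone B = {x. B *v x = 0}"

definition agent_objective ::
  "'w measure \<Rightarrow> ('m \<Rightarrow> 'x \<Rightarrow> 'e \<Rightarrow> real) \<Rightarrow> ('m \<Rightarrow> 'w \<Rightarrow> 'e) \<Rightarrow> 'm \<Rightarrow> 'x \<Rightarrow> real" where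
  "agent_objective M F \<xi> j x = (\<integral>\<omega>. F j x (\<xi> j \<omega>) \<partial>M)"

definition total_objective ::
  "'w measure \<Rightarrow> ('m::finite \<Rightarrow> 'x \<Rightarrow> 'e \<Rightarrow> real) \<Rightarrow> ('m \<Rightarrow> 'w \<Rightarrow> 'e) \<Rightarrow> 'x \<Rightarrow> real" where
  "total_objective M F \<xi> x = (\<Sum>j\<in>UNIV. agent_objective M F \<xi> j x)"

section \<open>Distributed dual averaging\<close>

definition Q_map :: "'a::real_inner set \<Rightarrow> 'a \<Rightarrow> 'a" where
  "Q_map X z = arg_max_on (\<lambda>x. z \<bullet> x - (norm x)\<^sup>2 / 2) X"

text \<open>\<open>dual_iter X F s z0 A \<zeta> k j \<omega>\<close> is agent \<open>j\<close>'s dual variable after \<open>k\<close> steps, for step sizes \<open>s\<close>,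
  weight matrices \<open>A\<close> and samples \<open>\<zeta>\<close>; the values of \<open>s\<close>, \<open>A\<close>, \<open>\<zeta>\<close> at time \<open>0\<close> are never used.\<close>

primrec dual_iter ::
  "(real^'d) set \<Rightarrow> ('m::finite \<Rightarrow> real^'d \<Rightarrow> 'e \<Rightarrow> real) \<Rightarrow> (nat \<Rightarrow> real) \<Rightarrow> ('m \<Rightarrow> 'w \<Rightarrow> real^'d) \<Rightarrow>
   (nat \<Rightarrow> 'w \<Rightarrow> real^'m^'m) \<Rightarrow> ('m \<Rightarrow> nat \<Rightarrow> 'w \<Rightarrow> 'e) \<Rightarrow> nat \<Rightarrow> 'm \<Rightarrow> 'w \<Rightarrow> real^'d" where
  "dual_iter X F s z0 A \<zeta> 0 = z0"
| "dual_iter X F s z0 A \<zeta> (Suc k) = (\<lambda>j \<omega>.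
     (\<Sum>i\<in>UNIV. A (Suc k) \<omega> $ j $ i *\<^sub>R dual_iter X F s z0 A \<zeta> k i \<omega>)
     - s (Suc k) *\<^sub>R gradient (\<lambda>y. F j y (\<zeta> j (Suc k) \<omega>))
                       (Q_map X (dual_iter X F s z0 A \<zeta> k j \<omega>)))"

definition dual_mean ::
  "(real^'d) set \<Rightarrow> ('m::finite \<Rightarrow> real^'d \<Rightarrow> 'e \<Rightarrow> real) \<Rightarrow> (nat \<Rightarrow> real) \<Rightarrow> ('m \<Rightarrow> 'w \<Rightarrow> real^'d) \<Rightarrow>
   (nat \<Rightarrow> 'w \<Rightarrow> real^'m^'m) \<Rightarrow> ('m \<Rightarrow> nat \<Rightarrow> 'w \<Rightarrow> 'e) \<Rightarrow> nat \<Rightarrow> 'w \<Rightarrow> real^'d" where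
  "dual_mean X F s z0 A \<zeta> k \<omega> =
     (1 / real CARD('m)) *\<^sub>R (\<Sum>j\<in>UNIV. dual_iter X F s z0 A \<zeta> k j \<omega>)"

text \<open>Meaningful for \<open>k \<ge> 1\<close>; because of truncated subtraction the value at \<open>0\<close> is that at \<open>1\<close>.\<close>

definition primal_mean ::
  "(real^'d) set \<Rightarrow> ('m::finite \<Rightarrow> real^'d \<Rightarrow> 'e \<Rightarrow> real) \<Rightarrow> (nat \<Rightarrow> real) \<Rightarrow> ('m \<Rightarrow> 'w \<Rightarrow> real^'d) \<Rightarrow>
   (nat \<Rightarrow> 'w \<Rightarrow> real^'m^'m) \<Rightarrow> ('m \<Rightarrow> nat \<Rightarrow> 'w \<Rightarrow> 'e) \<Rightarrow> nat \<Rightarrow> 'w \<Rightarrow> real^'d" where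
  "primal_mean X F s z0 A \<zeta> k \<omega> = Q_map X (dual_mean X F s z0 A \<zeta> (k - 1) \<omega>)"

section \<open>Weight matrices\<close>

definition doubly_stochastic :: "real^'m^'m \<Rightarrow> bool" where
  "doubly_stochastic W \<longleftrightarrow> (\<forall>i j. 0 \<le> W $ i $ j) \<and>
     (\<forall>i. (\<Sum>j\<in>UNIV. W $ i $ j) = 1) \<and> (\<forall>j. (\<Sum>i\<in>UNIV. W $ i $ j) = 1)"

definition spectral_norm :: "real^'n^'m \<Rightarrow> real" where
  "spectral_norm W = onorm (\<lambda>x. W *v x)"

definition averaging_matrix :: "real^'m^'m" where
  "averaging_matrix = (\<chi> i j. 1 / real CARD('m))"

section \<open>Filtration and conditional independence\<close>

definition gen_events :: "'w measure \<Rightarrow> ('w \<Rightarrow> 'a) \<Rightarrow> 'a measure \<Rightarrow> 'w set set" where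
  "gen_events M Y N = sets (vimage_algebra (space M) Y N)"

definition history ::
  "'w measure \<Rightarrow> ('m \<Rightarrow> 'e measure) \<Rightarrow> ('m::finite \<Rightarrow> 'w \<Rightarrow> real^'d) \<Rightarrow> (nat \<Rightarrow> 'w \<Rightarrow> real^'m^'m) \<Rightarrow>
   ('m \<Rightarrow> nat \<Rightarrow> 'w \<Rightarrow> 'e) \<Rightarrow> nat \<Rightarrow> 'w measure" where
  "history M S z0 A \<zeta> k = sigma (space M)
     ((\<Union>j. gen_events M (z0 j) borel) \<union>
      (\<Union>t\<in>{1..<k}. (\<Union>j. gen_events M (\<zeta> j t) (S j)) \<union> gen_events M (A t) borel))"

definition history_weights ::
  "'w measure \<Rightarrow> ('m \<Rightarrow> 'e measure) \<Rightarrow> ('m::finite \<Rightarrow> 'w \<Rightarrow> real^'d) \<Rightarrow> (nat \<Rightarrow> 'w \<Rightarrow> real^'m^'m) \<Rightarrow>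
   ('m \<Rightarrow> nat \<Rightarrow> 'w \<Rightarrow> 'e) \<Rightarrow> nat \<Rightarrow> 'w measure" where
  "history_weights M S z0 A \<zeta> k =
     sigma (space M) (sets (history M S z0 A \<zeta> k) \<union> gen_events M (A k) borel)"

definition cond_indep_set :: "'w measure \<Rightarrow> 'w measure \<Rightarrow> 'w set set \<Rightarrow> 'w set set \<Rightarrow> bool" where
  "cond_indep_set M G \<U> \<V> \<longleftrightarrow>
     (\<forall>U\<in>\<U>. \<forall>V\<in>\<V>. AE \<omega> in M.
        real_cond_exp M G (indicator (U \<inter> V)) \<omega> =
        real_cond_exp M G (indicator U) \<omega> * real_cond_exp M G (indicator V) \<omega>)"

end

theory Submission
  imports Defs
begin

text \<open>Summing the dual updates over the agents cancels the doubly stochastic weights, so the mean dual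
  variable after \<open>k\<close> steps is its initial value minus \<open>1/m\<close> times the step-weighted sum of all sampled
  gradients. Divided by the total step length it tends almost surely to \<open>- \<nabla>f(xs) / m\<close>: the sampling noise
  averages out, the agents' disagreement tends to \<open>0\<close> because its truncated second moments are summable,
  and the gradients are evaluated at points tending to \<open>xs\<close>. The residual of the Euclidean projection is
  therefore a large multiple of a vector close to \<open>- \<nabla>f(xs)\<close>, which lies in the relative interior of the
  normal cone, and this forces every constraint active at \<open>xs\<close> to be active at the projected point.\<close>

section \<open>Measurability of gradients\<close>

text \<open>The limit \<open>xs\<close> is given, so projected points stay bounded along almost
  every path; divided by the total step length, the residual of the projection has the same limit as
  the mean dual variable. Hence strong laws for step-weighted averages are the core, and qualitative
  convergence is enough. The step sizes enter through two facts: their sum diverges since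
  \<open>\<alpha> < 1\<close>, and their squares are summable since \<open>2 * \<alpha> > 1\<close>.
  The second bounds the noise martingale in second moment and makes the forcing term of the
  consensus recursion summable. Consensus is indispensable because gradients are sampled at each
  agent's own point, whereas convergence is known for the projection of the mean only; as projection
  is nonexpansive, dual disagreement controls primal disagreement. Noise is treated for one agent
  and one coordinate at a time, disagreement for one coordinate across all agents. The relative
  interior appears because the normal cone may be of lower dimension, so closeness to one of its
  points says something only about vectors in its span.\<close>

lemma gderiv_gradient:
  fixes f :: "'a::euclidean_space \<Rightarrow> real"
  assumes "f differentiable (at x)"
  shows "GDERIV f x :> gradient f x"
proof -
  obtain f' where f': "(f has_derivative f') (at x)"
    using assms by (auto simp: differentiable_def)
  interpret bounded_linear f' using f' by (rule has_derivative_bounded_linear)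
  have "f' h = h \<bullet> (\<Sum>b\<in>Basis. f' b *\<^sub>R b)" for h
    using sum[of "\<lambda>b. (h \<bullet> b) *\<^sub>R b" Basis]
    by (simp add: euclidean_representation inner_sum_right scale mult.commute)
  then have "f' = (\<lambda>h. h \<bullet> (\<Sum>b\<in>Basis. f' b *\<^sub>R b))" ..
  with f' have *: "GDERIV f x :> (\<Sum>b\<in>Basis. f' b *\<^sub>R b)"
    unfolding gderiv_def by simp
  show ?thesis using gradient_eqI[OF *] * by simp
qed

text \<open>The points may be any sequence equal to \<open>x + v / n\<close> up to an error
  \<open>o(1/n)\<close>; this freedom allows evaluation at grid points.\<close>

lemma gderiv_quotient_tendsto:
  fixes f :: "'a::real_inner \<Rightarrow> real"
  assumes deriv: "GDERIV f x :> g"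
    and y: "(\<lambda>n. real n *\<^sub>R (y n - x)) \<longlonglongrightarrow> v"
  shows "(\<lambda>n. real n * (f (y n) - f x)) \<longlonglongrightarrow> v \<bullet> g"
proof -
  \<comment> \<open>Normalised remainder, extended by 0 at the origin: it is continuous there, and
    indices with \<open>y n = x\<close> need no case of their own.\<close>
  define e where "e = (\<lambda>h. if h = 0 then 0 else (f (x + h) - f x - h \<bullet> g) / norm h)"
  have "((\<lambda>h. \<bar>(f (x + h) - f x - h \<bullet> g) / norm h\<bar>) \<longlongrightarrow> 0) (at 0)"
    using deriv by (simp add: gderiv_def has_derivative_at)
  then have "((\<lambda>h. (f (x + h) - f x - h \<bullet> g) / norm h) \<longlongrightarrow> 0) (at 0)"
    by (rule tendsto_rabs_zero_cancel)
  then have "(e \<longlongrightarrow> 0) (at 0)"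
    by (rule Lim_transform_eventually) (auto simp: e_def eventually_at_filter)
  moreover have e_0: "e 0 = 0" by (simp add: e_def)
  ultimately have e_cont: "isCont e 0" by (simp add: isCont_def)
  have inv: "(\<lambda>n. inverse (real n)) \<longlonglongrightarrow> 0"
    by (rule lim_inverse_n)
  have "(\<lambda>n. inverse (real n) *\<^sub>R (real n *\<^sub>R (y n - x))) \<longlonglongrightarrow> 0 *\<^sub>R v"
    by (intro tendsto_scaleR inv y)
  then have "(\<lambda>n. y n - x) \<longlonglongrightarrow> 0 *\<^sub>R v"
    by (rule Lim_transform_eventually) (auto intro!: eventually_sequentiallyI[of 1])
  then have "(\<lambda>n. e (y n - x)) \<longlonglongrightarrow> 0"
    using isCont_tendsto_compose[OF e_cont, of "\<lambda>n. y n - x" sequentially] e_0 by simp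
  then have "(\<lambda>n. (real n *\<^sub>R (y n - x)) \<bullet> g + e (y n - x) * norm (real n *\<^sub>R (y n - x)))
      \<longlonglongrightarrow> v \<bullet> g + 0 * norm v"
    by (intro tendsto_intros y)
  moreover have "(real n *\<^sub>R (y n - x)) \<bullet> g + e (y n - x) * norm (real n *\<^sub>R (y n - x))
      = real n * (f (y n) - f x)" for n
  proof -
    have "e (y n - x) * norm (y n - x) = f (y n) - f x - (y n - x) \<bullet> g"
      by (simp add: e_def)
    then show ?thesis
      by (simp only: inner_scaleR_left norm_scaleR abs_of_nat mult.left_commute[of _ "real n"]
          flip: distrib_left) simp
  qed
  ultimately show ?thesis by simp
qed

text \<open>The mesh \<open>1/n^2\<close> is finer than the step \<open>1/n\<close> of the
  difference quotients below, so rounding perturbs their direction only by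
  \<open>O(1/n)\<close>.\<close>

definition grid_round :: "nat \<Rightarrow> 'a::euclidean_space \<Rightarrow> 'a" where
  "grid_round n x = (\<Sum>b\<in>Basis. (real_of_int \<lfloor>(real n)\<^sup>2 * (x \<bullet> b)\<rfloor> / (real n)\<^sup>2) *\<^sub>R b)"

lemma grid_round_error:
  fixes x :: "'a::euclidean_space"
  assumes "n > 0"
  shows "norm (grid_round n x - x) \<le> DIM('a) / (real n)\<^sup>2"
proof -
  have "norm (grid_round n x - x)
      = norm (\<Sum>b\<in>Basis. (real_of_int \<lfloor>(real n)\<^sup>2 * (x \<bullet> b)\<rfloor> / (real n)\<^sup>2 - x \<bullet> b) *\<^sub>R b)"
    by (simp add: grid_round_def scaleR_left_diff_distrib sum_subtractf euclidean_representation)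
  also have "\<dots> \<le> (\<Sum>b\<in>(Basis::'a set). 1 / (real n)\<^sup>2)"
  proof (rule sum_norm_le)
    fix b :: 'a assume "b \<in> Basis"
    have "\<bar>real_of_int \<lfloor>(real n)\<^sup>2 * (x \<bullet> b)\<rfloor> / (real n)\<^sup>2 - x \<bullet> b\<bar>
        = \<bar>real_of_int \<lfloor>(real n)\<^sup>2 * (x \<bullet> b)\<rfloor> - (real n)\<^sup>2 * (x \<bullet> b)\<bar> / (real n)\<^sup>2"
      using assms by (simp add: field_simps abs_if)
    also have "\<dots> \<le> 1 / (real n)\<^sup>2"
      by (rule divide_right_mono[OF _ zero_le_power2]) linarith
    finally show "norm ((real_of_int \<lfloor>(real n)\<^sup>2 * (x \<bullet> b)\<rfloor> / (real n)\<^sup>2 - x \<bullet> b) *\<^sub>R b)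
        \<le> 1 / (real n)\<^sup>2"
      using \<open>b \<in> Basis\<close> by simp
  qed
  finally show ?thesis by simp
qed

lemma borel_measurable_grid_round [measurable]: "grid_round n \<in> borel_measurable borel"
  unfolding grid_round_def by measurable

lemma countable_range_grid_round: "countable (range (grid_round n :: 'a::euclidean_space \<Rightarrow> 'a))"
proof -
  let ?h = "\<lambda>c :: 'a \<Rightarrow> int. \<Sum>b\<in>Basis. (real_of_int (c b) / (real n)\<^sup>2) *\<^sub>R b"
  have "grid_round n x \<in> ?h ` (PiE Basis (\<lambda>_. UNIV))" for x :: 'a
    by (rule image_eqI[of _ _ "restrict (\<lambda>b. \<lfloor>(real n)\<^sup>2 * (x \<bullet> b)\<rfloor>) Basis"])
       (auto simp: grid_round_def)
  then have "range (grid_round n :: 'a \<Rightarrow> 'a) \<subseteq> ?h ` (PiE Basis (\<lambda>_. UNIV))" by blast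
  then show ?thesis
    by (rule countable_subset) (intro countable_image countable_PiE finite_Basis, simp)
qed

text \<open>\<open>F\<close> need not be jointly measurable off the set of points of differentiability, so difference
  quotients are taken between points of countable grids.\<close>

lemma borel_measurable_gradient:
  fixes F :: "'a::euclidean_space \<Rightarrow> 'e \<Rightarrow> real"
  assumes F: "\<And>y. F y \<in> borel_measurable T"
    and \<zeta> [measurable]: "\<zeta> \<in> measurable N T"
    and x [measurable]: "x \<in> borel_measurable N"
    and diff: "\<And>w. w \<in> space N \<Longrightarrow> (\<lambda>y. F y (\<zeta> w)) differentiable (at (x w))"
  shows "(\<lambda>w. gradient (\<lambda>y. F y (\<zeta> w)) (x w)) \<in> borel_measurable N"
proof -
  \<comment> \<open>The rounded point takes countably many values, so measurability of each section
    \<open>F y\<close> suffices.\<close>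
  have grid: "(\<lambda>w. F (grid_round n (u w)) (\<zeta> w)) \<in> borel_measurable N"
    if u: "u \<in> borel_measurable N" for n u
  proof (rule measurable_compose_countable'[where I = "range (grid_round n)"
        and f = "\<lambda>i w. F i (\<zeta> w)" and g = "\<lambda>w. grid_round n (u w)"])
    show "(\<lambda>w. F i (\<zeta> w)) \<in> borel_measurable N" for i
      by (rule measurable_compose[OF \<zeta> F])
    show "(\<lambda>w. grid_round n (u w)) \<in> measurable N (count_space (range (grid_round n)))"
    proof (rule measurable_count_space_eq_countable[OF countable_range_grid_round, THEN iffD2],
        intro conjI ballI)
      fix a :: 'a
      show "(\<lambda>w. grid_round n (u w)) -` {a} \<inter> space N \<in> sets N"
        by (rule measurable_sets[OF measurable_compose[OF u borel_measurable_grid_round]]) simp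
    qed auto
  qed (rule countable_range_grid_round)
  have close: "(\<lambda>n. real n *\<^sub>R (grid_round n (z + (1 / real n) *\<^sub>R v) - z)) \<longlonglongrightarrow> v"
    for z v :: 'a
  proof -
    let ?d = "\<lambda>n. real n *\<^sub>R (grid_round n (z + (1 / real n) *\<^sub>R v) - z)"
    have "norm (?d n - v) \<le> DIM('a) * inverse (real n)" if "n \<ge> 1" for n
    proof -
      have "?d n - v = real n *\<^sub>R (grid_round n (z + (1 / real n) *\<^sub>R v) - (z + (1 / real n) *\<^sub>R v))"
        using that by (simp add: algebra_simps)
      then have "norm (?d n - v)
          = real n * norm (grid_round n (z + (1 / real n) *\<^sub>R v) - (z + (1 / real n) *\<^sub>R v))"
        by (simp only: norm_scaleR abs_of_nat)
      also have "\<dots> \<le> real n * (DIM('a) / (real n)\<^sup>2)"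
        using that by (intro mult_left_mono grid_round_error) auto
      also have "\<dots> = DIM('a) * inverse (real n)"
        using that by (simp add: field_simps power2_eq_square)
      finally show ?thesis .
    qed
    then have "eventually (\<lambda>n. norm (?d n - v) \<le> DIM('a) * inverse (real n)) sequentially"
      by (rule eventually_sequentiallyI)
    moreover have "(\<lambda>n. DIM('a) * inverse (real n)) \<longlonglongrightarrow> 0"
      by (rule tendsto_mult_right_zero[OF lim_inverse_n])
    ultimately show ?thesis
      by (rule LIM_zero_cancel[OF Lim_null_comparison])
  qed
  show ?thesis
  proof (subst borel_measurable_euclidean_space, intro ballI)
    fix b :: 'a assume "b \<in> Basis"
    \<comment> \<open>The base point is rounded as well, as direction \<open>0\<close>, because
      \<open>F\<close> at the random point \<open>x w\<close> need not be measurable in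
      \<open>w\<close>. The difference of the two quotients converges to the derivative along
      \<open>b\<close>.\<close>
    define u where "u = (\<lambda>n w. real n * (F (grid_round n (x w + (1 / real n) *\<^sub>R b)) (\<zeta> w)
      - F (grid_round n (x w + (1 / real n) *\<^sub>R 0)) (\<zeta> w)))"
    show "(\<lambda>w. gradient (\<lambda>y. F y (\<zeta> w)) (x w) \<bullet> b) \<in> borel_measurable N"
    proof (rule borel_measurable_LIMSEQ_real[where u = u])
      show "u n \<in> borel_measurable N" for n
        unfolding u_def by (intro borel_measurable_times borel_measurable_diff grid) measurable
      fix w assume w: "w \<in> space N"
      note q = gderiv_quotient_tendsto[OF gderiv_gradient[OF diff[OF w]]]
      show "(\<lambda>n. u n w) \<longlonglongrightarrow> gradient (\<lambda>y. F y (\<zeta> w)) (x w) \<bullet> b"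
        using tendsto_diff[OF q[OF close[of "x w" b]] q[OF close[of "x w" 0]]]
        by (simp add: u_def right_diff_distrib inner_commute)
    qed
  qed
qed

section \<open>Projection onto a polyhedron\<close>

text \<open>Completing the square turns the maximisation into minimising the distance to
  \<open>z\<close>. Uniqueness of the nearest point determines the value picked by
  \<open>arg_max_on\<close>.\<close>

lemma Q_map_eq_closest_point:
  fixes X :: "'a::euclidean_space set"
  assumes "convex X" "closed X" "X \<noteq> {}"
  shows "Q_map X z = closest_point X z"
proof -
  let ?f = "\<lambda>x. z \<bullet> x - (norm x)\<^sup>2 / 2"
  have f: "?f x = ((norm z)\<^sup>2 - (dist z x)\<^sup>2) / 2" for x
    by (simp add: dist_norm power2_norm_eq_inner inner_diff_left inner_diff_right inner_commute
        field_simps)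
  have le: "?f x \<le> ?f y \<longleftrightarrow> dist z y \<le> dist z x" for x y
    unfolding f by (simp add: power2_le_iff_abs_le)
  have "is_arg_max ?f (\<lambda>x. x \<in> X) (closest_point X z)"
    using closest_point_in_set closest_point_le assms
    unfolding is_arg_max_linorder le by metis
  then have "is_arg_max ?f (\<lambda>x. x \<in> X) (Q_map X z)"
    unfolding Q_map_def arg_max_on_def arg_max_def by (rule someI)
  then show ?thesis
    unfolding is_arg_max_linorder le
    by (intro closest_point_unique assms) auto
qed

lemma convex_feasible_set: "convex (feasible_set B b C c)"
proof -
  have *: "{x. (B *v x - b) $ i \<le> 0} = {x. B $ i \<bullet> x \<le> b $ i}" for B :: "real^'x^'y" and b i
    by (auto simp: matrix_vector_mul_component)
  have "feasible_set B b C c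
      = (\<Inter>i. {x. (B *v x - b) $ i \<le> 0}) \<inter> (\<Inter>i. {x. (C *v x - c) $ i \<le> 0})"
    by (auto simp: feasible_set_def)
  then show ?thesis
    by (simp only: *) (intro convex_Int convex_INT convex_halfspace_le)
qed

lemma closed_feasible_set: "closed (feasible_set B b C c)"
proof -
  have *: "{x. (B *v x - b) $ i \<le> 0} = {x. B $ i \<bullet> x \<le> b $ i}" for B :: "real^'x^'y" and b i
    by (auto simp: matrix_vector_mul_component)
  have "feasible_set B b C c
      = (\<Inter>i. {x. (B *v x - b) $ i \<le> 0}) \<inter> (\<Inter>i. {x. (C *v x - c) $ i \<le> 0})"
    by (auto simp: feasible_set_def)
  then show ?thesis
    by (simp only: *) (intro closed_Int closed_INT ballI closed_halfspace_le)
qed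

text \<open>The row space is the orthogonal complement of the kernel: the part of \<open>v\<close>
  orthogonal to the range of the transpose lies in the kernel of \<open>B\<close>, hence is
  orthogonal to \<open>v\<close> and so to itself.\<close>

lemma orthogonal_kernel_imp_range_transpose:
  fixes B :: "real^'d^'p"
  assumes "\<And>h. B *v h = 0 \<Longrightarrow> v \<bullet> h = 0"
  shows "v \<in> range ((*v) (transpose B))"
proof -
  let ?R = "range ((*v) (transpose B))"
  have R: "subspace ?R"
    by (intro linear_subspace_image matrix_vector_mul_linear subspace_UNIV)
  obtain r n where rn: "r \<in> span ?R" "\<And>w. w \<in> span ?R \<Longrightarrow> orthogonal n w" "v = r + n"
    using orthogonal_subspace_decomp_exists[of ?R v] by metis
  have "(B *v n) \<bullet> l = 0" for l
    using rn(2)[of "transpose B *v l"] R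
    by (simp add: orthogonal_def transpose_matrix_vector dot_lmul_matrix
        span_eq_iff[THEN iffD2] inner_commute[of n] inner_commute[of "B *v n"])
  then have Bn: "B *v n = 0" by (metis inner_eq_zero_iff)
  have "n \<bullet> r = 0" using rn(2)[OF rn(1)] by (simp add: orthogonal_def)
  then have "n = 0" using assms[OF Bn] rn(3) by (simp add: inner_add_left inner_commute[of r])
  then show ?thesis using rn R by (simp add: span_eq_iff[THEN iffD2])
qed

text \<open>Split \<open>l\<close> into positive and negative parts: the span contains rows with
  either sign, though the cone only guarantees one.\<close>

lemma range_transpose_subset_span_active_normal_cone:
  "range ((*v) (transpose B)) \<subseteq> span (active_normal_cone B)"
proof safe
  fix l :: "real^'b"
  define lp lm where "lp = (\<chi> i. max (l $ i) 0)" and "lm = (\<chi> i. max (- l $ i) 0)"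
  have "l = lp - lm" by (auto simp: lp_def lm_def vec_eq_iff)
  then have "transpose B *v l = transpose B *v lp - transpose B *v lm"
    by (simp add: matrix_vector_mult_diff_distrib)
  moreover have "transpose B *v lp \<in> active_normal_cone B" "transpose B *v lm \<in> active_normal_cone B"
    by (auto simp: active_normal_cone_def lp_def lm_def)
  ultimately show "transpose B *v l \<in> span (active_normal_cone B)"
    by (simp add: span_base span_diff)
qed

text \<open>The displacement \<open>z - P z\<close> of the projection is orthogonal to the kernel of \<open>B\<close> once the other
  constraints are slack, hence lies in the span of the cone. Rescaled it tends to a relative interior
  point of the cone, so a multiple of any single row of \<open>B\<close> can be subtracted without leaving the cone;
  testing against \<open>P z - xs\<close> forces that row to be active.\<close>

lemma eventually_projection_active:
  fixes B :: "real^'d^'p" and C :: "real^'d^'q" and b c and z :: "nat \<Rightarrow> real^'d"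
  defines "X \<equiv> feasible_set B b C c"
  assumes X: "convex X" "closed X"
    and xs: "xs \<in> X" "B *v xs = b"
    and slack: "eventually (\<lambda>k. \<forall>i. (C *v closest_point X (z k)) $ i < c $ i) sequentially"
    and s: "eventually (\<lambda>k. s k > 0) sequentially"
    and lim: "(\<lambda>k. (1 / s k) *\<^sub>R (z k - closest_point X (z k))) \<longlonglongrightarrow> g"
    and g: "g \<in> rel_interior (active_normal_cone B)"
  shows "eventually (\<lambda>k. B *v closest_point X (z k) = b) sequentially"
proof -
  let ?N = "active_normal_cone B"
  define x where "x = (\<lambda>k. closest_point X (z k))"
  define v where "v = (\<lambda>k. z k - x k)"
  have xX: "x k \<in> X" for k
    unfolding x_def using X xs closest_point_in_set by blast
  have normal: "v k \<bullet> (y - x k) \<le> 0" if "y \<in> X" for y k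
    unfolding v_def x_def using closest_point_dot[OF X that] .
  obtain e where e: "e > 0" "ball g e \<inter> affine hull ?N \<subseteq> ?N"
    using g unfolding mem_rel_interior_ball by blast
  have "0 \<in> ?N" unfolding active_normal_cone_def by (auto intro!: exI[of _ 0])
  \<comment> \<open>Because the cone contains 0, the affine hull in the definition of the relative
    interior is a linear span, which subtracting rows does not leave.\<close>
  then have hull: "affine hull ?N = span ?N"
    by (intro affine_hull_span_0 hull_inc)
  have range: "v k \<in> range ((*v) (transpose B))" if sl: "\<forall>i. (C *v x k) $ i < c $ i" for k
  proof (rule orthogonal_kernel_imp_range_transpose)
    fix h assume h: "B *v h = 0"
    \<comment> \<open>Strict slackness of the \<open>C\<close> constraints leaves room to move a
      little both ways along \<open>h\<close>, and \<open>B *v h = 0\<close> keeps the others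
      unchanged; the variational inequality in both directions gives equality.\<close>
    have "eventually (\<lambda>t. \<forall>i. (C *v (x k + t *\<^sub>R h)) $ i < c $ i) (nhds (0::real))"
    proof (intro eventually_all_finite allI)
      fix i
      have "((\<lambda>t. (C *v (x k)) $ i + t * (C *v h) $ i) \<longlongrightarrow> (C *v (x k)) $ i + 0 * (C *v h) $ i)
          (nhds (0::real))"
        by (intro tendsto_intros filterlim_ident)
      from order_tendstoD(2)[OF this, of "c $ i"] sl
      show "eventually (\<lambda>t. (C *v (x k + t *\<^sub>R h)) $ i < c $ i) (nhds (0::real))"
        by (simp add: matrix_vector_right_distrib matrix_vector_mult_scaleR)
    qed
    then obtain d where d: "d > 0"
      "\<And>t i. \<bar>t\<bar> < d \<Longrightarrow> (C *v (x k + t *\<^sub>R h)) $ i < c $ i"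
      unfolding eventually_nhds_metric by (auto simp: dist_real_def)
    have mem: "x k + t *\<^sub>R h \<in> X" if "\<bar>t\<bar> < d" for t
      using d(2)[OF that] xX[of k] h
      by (auto simp: X_def feasible_set_def matrix_vector_right_distrib matrix_vector_mult_scaleR
          intro: less_imp_le)
    have "v k \<bullet> ((d / 2) *\<^sub>R h) \<le> 0" "v k \<bullet> ((- d / 2) *\<^sub>R h) \<le> 0"
      using normal[OF mem[of "d / 2"], of k] normal[OF mem[of "- d / 2"], of k] d(1) by simp_all
    then show "v k \<bullet> h = 0"
      using d(1) by (simp add: zero_le_mult_iff mult_le_0_iff)
  qed
  have "eventually (\<lambda>k. (B *v x k) $ i = b $ i) sequentially" for i
  proof -
    define n where "n = transpose B *v axis i 1"
    \<comment> \<open>Chosen so that the shift uses at most half of the radius \<open>e\<close>,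
      leaving the other half for the distance to \<open>g\<close>; the \<open>+ 1\<close> covers a
      zero row.\<close>
    define \<eta> where "\<eta> = e / (2 * (norm n + 1))"
    have \<eta>: "\<eta> > 0" using e by (simp add: \<eta>_def add_nonneg_pos)
    have "norm n * e \<le> (norm n + 1) * e" using e by (simp add: mult_right_mono)
    then have \<eta>n: "\<eta> * norm n \<le> e / 2"
      using e by (simp add: \<eta>_def field_simps add_pos_nonneg)
    have n_dot: "n \<bullet> h = (B *v h) $ i" for h
      unfolding n_def
      by (metis dot_lmul_matrix inner_axis inner_commute inner_real_def mult.right_neutral
          transpose_matrix_vector)
    have n_span: "n \<in> span ?N"
      unfolding n_def using range_transpose_subset_span_active_normal_cone by blast
    have close: "eventually (\<lambda>k. dist ((1 / s k) *\<^sub>R v k) g < e / 2) sequentially"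
      using tendstoD[OF lim, of "e / 2"] e by (simp add: v_def x_def)
    show ?thesis
      using close s slack
    proof eventually_elim
      case (elim k)
      define w where "w = (1 / s k) *\<^sub>R v k - \<eta> *\<^sub>R n"
      define h where "h = x k - xs"
      have "norm (w - g) \<le> dist ((1 / s k) *\<^sub>R v k) g + norm (\<eta> *\<^sub>R n)"
        unfolding w_def dist_norm
        using norm_triangle_ineq4[of "(1 / s k) *\<^sub>R v k - g" "\<eta> *\<^sub>R n"]
        by (simp add: algebra_simps)
      also have "\<dots> < e" using elim(1) \<eta>n \<eta> by simp
      finally have "w \<in> ball g e" by (simp add: dist_norm norm_minus_commute)
      moreover have "v k \<in> span ?N"
        using range[of k] elim(3) range_transpose_subset_span_active_normal_cone
        unfolding x_def by blast
      then have "w \<in> span ?N"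
        unfolding w_def by (intro span_diff span_scale n_span)
      ultimately have "w \<in> ?N" using e(2) hull by blast
      then obtain l where l: "\<And>i. 0 \<le> l $ i" "w = transpose B *v l"
        unfolding active_normal_cone_def by blast
      have Bh: "(B *v h) $ j \<le> 0" for j
        using xX[of k] xs(2) by (simp add: h_def X_def feasible_set_def matrix_vector_mult_diff_distrib)
      \<comment> \<open>Membership of \<open>w\<close> in the cone makes
        \<open>w \<bullet> h\<close> nonpositive, while the variational inequality at
        \<open>xs\<close> makes \<open>v k \<bullet> h\<close> nonnegative; this forces
        \<open>n \<bullet> h \<ge> 0\<close>, the reverse of the feasibility inequality.\<close>
      have "w \<bullet> h = l \<bullet> (B *v h)"
        unfolding l(2) by (metis dot_lmul_matrix transpose_matrix_vector)
      also have "\<dots> \<le> 0"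
        unfolding inner_vec_def using l(1) Bh by (auto intro!: sum_nonpos mult_nonneg_nonpos)
      finally have "(1 / s k) * (v k \<bullet> h) - \<eta> * (n \<bullet> h) \<le> 0"
        by (simp add: w_def inner_diff_left)
      moreover have "v k \<bullet> h \<ge> 0"
        using normal[OF xs(1), of k] by (simp add: h_def inner_diff_right)
      then have "(1 / s k) * (v k \<bullet> h) \<ge> 0" using elim(2) by simp
      ultimately have "\<eta> * (n \<bullet> h) \<ge> 0" by linarith
      then have "(B *v h) $ i \<ge> 0" using \<eta> n_dot by (simp add: zero_le_mult_iff)
      with Bh[of i] show ?case
        using xs(2) by (simp add: h_def matrix_vector_mult_diff_distrib)
    qed
  qed
  then have "eventually (\<lambda>k. \<forall>i. (B *v x k) $ i = b $ i) sequentially"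
    by (intro eventually_all_finite) blast
  then show ?thesis
    by eventually_elim (simp add: vec_eq_iff x_def)
qed

section \<open>Averages of square-integrable noise\<close>

text \<open>Toeplitz averaging: the finitely many early terms contribute a bounded amount, which the
  diverging total weight drowns.\<close>

lemma weighted_average_tendsto:
  fixes y :: "nat \<Rightarrow> 'a::real_normed_vector"
  assumes w: "\<And>t. 0 \<le> w t"
    and W: "filterlim (\<lambda>k. \<Sum>t=1..k. w t) at_top sequentially"
    and y: "y \<longlonglongrightarrow> l"
  shows "(\<lambda>k. (1 / (\<Sum>t=1..k. w t)) *\<^sub>R (\<Sum>t=1..k. w t *\<^sub>R y t)) \<longlonglongrightarrow> l"
proof (rule LIMSEQ_I)
  fix e :: real assume "e > 0"
  define s where "s = (\<lambda>k. \<Sum>t=1..k. w t)"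
  obtain n where n: "\<And>t. t \<ge> n \<Longrightarrow> norm (y t - l) < e / 2"
    using LIMSEQ_D[OF y, of "e / 2"] \<open>e > 0\<close> by auto
  define K where "K = (\<Sum>t<n. w t * norm (y t - l))"
  have K: "K \<ge> 0" unfolding K_def by (intro sum_nonneg) (simp add: w)
  \<comment> \<open>This threshold makes \<open>K / s k\<close> smaller than \<open>e / 2\<close>;
    the late terms account for the other half.\<close>
  have "eventually (\<lambda>k. s k \<ge> 2 * K / e + 1) sequentially"
    using W unfolding filterlim_at_top s_def by blast
  then obtain m where m: "\<And>k. k \<ge> m \<Longrightarrow> s k \<ge> 2 * K / e + 1"
    unfolding eventually_sequentially by blast
  have "norm ((1 / s k) *\<^sub>R (\<Sum>t=1..k. w t *\<^sub>R y t) - l) < e" if "k \<ge> m" for k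
  proof -
    have "2 * K / e + 1 > 0" using K \<open>e > 0\<close> by (simp add: add_nonneg_pos)
    then have sk: "s k > 0" using m[OF that] by linarith
    have "(1 / s k) *\<^sub>R (\<Sum>t=1..k. w t *\<^sub>R y t) - l = (1 / s k) *\<^sub>R (\<Sum>t=1..k. w t *\<^sub>R (y t - l))"
      using sk by (simp add: scaleR_right_diff_distrib sum_subtractf s_def flip: scaleR_left.sum)
    then have "norm ((1 / s k) *\<^sub>R (\<Sum>t=1..k. w t *\<^sub>R y t) - l)
        \<le> (1 / s k) * (\<Sum>t=1..k. w t * norm (y t - l))"
      using sk by (auto intro!: divide_right_mono order_trans[OF norm_sum] sum_mono simp: w)
    also have "(\<Sum>t=1..k. w t * norm (y t - l))
        \<le> (\<Sum>t=1..k. (if t < n then w t * norm (y t - l) else 0) + w t * (e / 2))"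
    proof (rule sum_mono)
      fix t
      have "0 \<le> w t * (e / 2)" using w \<open>e > 0\<close> by simp
      moreover have "w t * norm (y t - l) \<le> w t * (e / 2)" if "t \<ge> n"
        using n[OF that] w by (intro mult_left_mono) auto
      ultimately show "w t * norm (y t - l)
          \<le> (if t < n then w t * norm (y t - l) else 0) + w t * (e / 2)"
        by auto
    qed
    also have "\<dots> = (\<Sum>t=1..k. if t < n then w t * norm (y t - l) else 0) + s k * (e / 2)"
      by (simp add: sum.distrib s_def sum_distrib_right)
    also have "(\<Sum>t=1..k. if t < n then w t * norm (y t - l) else 0) \<le> K"
      unfolding K_def sum.inter_filter[symmetric, OF finite_atLeastAtMost]
      by (intro sum_mono2) (auto simp: w)
    finally have "norm ((1 / s k) *\<^sub>R (\<Sum>t=1..k. w t *\<^sub>R y t) - l) \<le> (1 / s k) * (K + s k * (e / 2))"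
      using sk by (simp add: divide_right_mono)
    also have "\<dots> < e"
    proof -
      have "2 * K < e * s k"
        using m[OF that] \<open>e > 0\<close> by (simp add: field_simps)
      then show ?thesis using sk by (simp add: field_simps)
    qed
    finally show ?thesis .
  qed
  then show "\<exists>m. \<forall>k\<ge>m. norm ((1 / (\<Sum>t=1..k. w t)) *\<^sub>R (\<Sum>t=1..k. w t *\<^sub>R y t) - l) < e"
    unfolding s_def by blast
qed

text \<open>By monotone convergence the series has finite expectation, so it is finite almost surely
  and its terms vanish. This takes the role of a Borel-Cantelli argument, for the noise and for
  consensus.\<close>

lemma AE_tendsto_0_if_summable_integral:
  fixes X :: "nat \<Rightarrow> 'a \<Rightarrow> real"
  assumes int: "\<And>i. integrable M (X i)"
    and nonneg: "\<And>i w. 0 \<le> X i w"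
    and summ: "summable (\<lambda>i. \<integral>w. X i w \<partial>M)"
  shows "AE w in M. (\<lambda>i. X i w) \<longlonglongrightarrow> 0"
proof -
  have [measurable]: "X i \<in> borel_measurable M" for i using int by auto
  have "(\<integral>\<^sup>+w. (\<Sum>i. ennreal (X i w)) \<partial>M) = (\<Sum>i. \<integral>\<^sup>+w. ennreal (X i w) \<partial>M)"
    by (rule nn_integral_suminf) measurable
  also have "\<dots> = (\<Sum>i. ennreal (\<integral>w. X i w \<partial>M))"
    by (simp add: nn_integral_eq_integral int nonneg)
  also have "\<dots> \<noteq> \<infinity>"
    using summ by (subst suminf_ennreal2) (auto intro: integral_nonneg_AE simp: nonneg)
  finally have "AE w in M. (\<Sum>i. ennreal (X i w)) \<noteq> \<infinity>"
    by (intro nn_integral_PInf_AE) auto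
  then show ?thesis
  proof eventually_elim
    case (elim w)
    then have "summable (\<lambda>i. X i w)"
      by (intro summable_suminf_not_top) (auto simp: nonneg)
    then show ?case by (rule summable_LIMSEQ_zero)
  qed
qed

text \<open>Cauchy-Schwarz with each weight split into two square roots, so that the total weight
  enters and not the number of terms.\<close>

lemma sum_weighted_square_le:
  fixes w x :: "'i \<Rightarrow> real"
  assumes "\<And>t. t \<in> T \<Longrightarrow> 0 \<le> w t"
  shows "(\<Sum>t\<in>T. w t * \<bar>x t\<bar>)\<^sup>2 \<le> (\<Sum>t\<in>T. w t) * (\<Sum>t\<in>T. w t * (x t)\<^sup>2)"
proof -
  have "(\<Sum>t\<in>T. w t * \<bar>x t\<bar>) = (\<Sum>t\<in>T. sqrt (w t) * (sqrt (w t) * \<bar>x t\<bar>))"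
    using assms by (intro sum.cong refl) simp
  also have "\<dots>\<^sup>2 \<le> (\<Sum>t\<in>T. (sqrt (w t))\<^sup>2) * (\<Sum>t\<in>T. (sqrt (w t) * \<bar>x t\<bar>)\<^sup>2)"
    by (rule Cauchy_Schwarz_ineq_sum)
  also have "\<dots> = (\<Sum>t\<in>T. w t) * (\<Sum>t\<in>T. w t * (x t)\<^sup>2)"
    using assms by (simp add: power_mult_distrib)
  finally show ?thesis .
qed

text \<open>No maximal inequality is needed: cut time into blocks over which the total weight grows by about
  one. The sum at the start of block \<open>j\<close> and the sum of absolute values inside it are both bounded in
  \<open>L\<^sup>2\<close>, so divided by \<open>j\<close> they have summable second moments.\<close>

lemma (in prob_space) AE_weighted_average_tendsto_0:
  fixes N :: "nat \<Rightarrow> 'a \<Rightarrow> real"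
  assumes w: "\<And>t. 0 \<le> w t" "\<And>t. w t \<le> a"
    and W: "filterlim (\<lambda>k. \<Sum>t=1..k. w t) at_top sequentially"
    and N [measurable]: "\<And>t. N t \<in> borel_measurable M"
    and N2: "\<And>t. integrable M (\<lambda>\<omega>. (N t \<omega>)\<^sup>2)" "\<And>t. expectation (\<lambda>\<omega>. (N t \<omega>)\<^sup>2) \<le> V0"
    and M2: "\<And>k. integrable M (\<lambda>\<omega>. (\<Sum>t=1..k. w t * N t \<omega>)\<^sup>2)"
      "\<And>k. expectation (\<lambda>\<omega>. (\<Sum>t=1..k. w t * N t \<omega>)\<^sup>2) \<le> V"
  shows "AE \<omega> in M. (\<lambda>k. (\<Sum>t=1..k. w t * N t \<omega>) / (\<Sum>t=1..k. w t)) \<longlonglongrightarrow> 0"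
proof -
  define s where "s = (\<lambda>k. \<Sum>t=1..k. w t)"
  define m where "m = (\<lambda>k \<omega>. \<Sum>t=1..k. w t * N t \<omega>)"
  \<comment> \<open>\<open>\<kappa> i\<close> is the first time at which the total weight reaches
    \<open>i\<close>; as single weights are at most \<open>a\<close>, it overshoots by at most
    \<open>a\<close>, whence block weights of at most \<open>1 + a\<close>.\<close>
  define \<kappa> where "\<kappa> = (\<lambda>i::nat. LEAST k. s k \<ge> real i)"
  define D where "D = (\<lambda>i \<omega>. \<Sum>t\<in>{\<kappa> i<..\<kappa> (Suc i)}. w t * \<bar>N t \<omega>\<bar>)"
  have a: "a \<ge> 0" using w[of 0] by linarith
  have V0: "V0 \<ge> 0"
    by (rule order_trans[OF integral_nonneg_AE N2(2)[of 0]]) simp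
  have s_split: "s k' = s k + (\<Sum>t\<in>{k<..k'}. w t)" if "k \<le> k'" for k k'
  proof -
    have split: "{1..k'} = {1..k} \<union> {k<..k'}" using that by auto
    show ?thesis unfolding s_def split by (subst sum.union_disjoint) auto
  qed
  have s_mono: "s k \<le> s k'" if "k \<le> k'" for k k'
    unfolding s_split[OF that] by (simp add: sum_nonneg w)
  have \<kappa>1: "s (\<kappa> i) \<ge> real i" for i
  proof -
    have "eventually (\<lambda>k. s k \<ge> real i) sequentially"
      using W unfolding filterlim_at_top s_def by blast
    then have "\<exists>k. s k \<ge> real i" by (auto simp: eventually_sequentially)
    then show ?thesis unfolding \<kappa>_def by (rule LeastI_ex)
  qed
  have \<kappa>_le: "\<kappa> i \<le> k" if "s k \<ge> real i" for i k
    unfolding \<kappa>_def using that by (rule Least_le)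
  have \<kappa>2: "s (\<kappa> i) \<le> real i + a" for i
  proof (cases "\<kappa> i")
    case 0
    then show ?thesis using a by (simp add: s_def)
  next
    case (Suc k)
    then have "s k < real i" using \<kappa>_le[of i k] by force
    moreover have "s (Suc k) = s k + w (Suc k)" by (simp add: s_def)
    ultimately show ?thesis using Suc w(2)[of "Suc k"] by simp
  qed
  have \<kappa>_mono: "\<kappa> i \<le> \<kappa> (Suc i)" for i
    using \<kappa>1[of "Suc i"] by (intro \<kappa>_le) simp
  have block: "(\<Sum>t\<in>{\<kappa> i<..\<kappa> (Suc i)}. w t) \<le> 1 + a" for i
    using s_split[OF \<kappa>_mono[of i]] \<kappa>2[of "Suc i"] \<kappa>1[of i] by simp
  have D2: "(D i \<omega>)\<^sup>2 \<le> (1 + a) * (\<Sum>t\<in>{\<kappa> i<..\<kappa> (Suc i)}. w t * (N t \<omega>)\<^sup>2)" for i \<omega>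
    unfolding D_def
    by (intro order_trans[OF sum_weighted_square_le] mult_right_mono block sum_nonneg) (auto simp: w)
  have D_meas [measurable]: "D i \<in> borel_measurable M" for i unfolding D_def by measurable
  have D_int: "integrable M (\<lambda>\<omega>. (D i \<omega>)\<^sup>2)" for i
    by (rule Bochner_Integration.integrable_bound[where
          f = "\<lambda>\<omega>. (1 + a) * (\<Sum>t\<in>{\<kappa> i<..\<kappa> (Suc i)}. w t * (N t \<omega>)\<^sup>2)"])
       (auto intro!: AE_I2 order_trans[OF D2] integrable_sum integrable_mult_right N2(1))
  have D_bound: "expectation (\<lambda>\<omega>. (D i \<omega>)\<^sup>2) \<le> (1 + a) * ((1 + a) * V0)" for i
  proof -
    have "expectation (\<lambda>\<omega>. (D i \<omega>)\<^sup>2)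
        \<le> expectation (\<lambda>\<omega>. (1 + a) * (\<Sum>t\<in>{\<kappa> i<..\<kappa> (Suc i)}. w t * (N t \<omega>)\<^sup>2))"
      by (intro integral_mono D_int D2) (auto intro!: N2(1))
    also have "\<dots> = (1 + a) * (\<Sum>t\<in>{\<kappa> i<..\<kappa> (Suc i)}. w t * expectation (\<lambda>\<omega>. (N t \<omega>)\<^sup>2))"
      by (simp add: N2(1))
    also have "\<dots> \<le> (1 + a) * (\<Sum>t\<in>{\<kappa> i<..\<kappa> (Suc i)}. w t * V0)"
      using a by (intro mult_left_mono sum_mono N2(2)) (auto simp: w)
    also have "\<dots> \<le> (1 + a) * ((1 + a) * V0)"
      unfolding sum_distrib_right[symmetric] using a V0 block
      by (intro mult_left_mono mult_right_mono) auto
    finally show ?thesis .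
  qed
  \<comment> \<open>The index is shifted so that the divisor is never 0: \<open>P i\<close> controls
    block \<open>Suc i\<close>. Bounded second moments divided by squares are summable.\<close>
  define P where "P = (\<lambda>i \<omega>. ((m (\<kappa> (Suc i)) \<omega>)\<^sup>2 + (D (Suc i) \<omega>)\<^sup>2) / (real (Suc i))\<^sup>2)"
  have P_int: "integrable M (P i)" for i
    unfolding P_def m_def
    by (intro integrable_divide Bochner_Integration.integrable_add M2 D_int)
  have P_bound: "expectation (P i) \<le> (V + (1 + a) * ((1 + a) * V0)) * (1 / (real (Suc i))\<^sup>2)" for i
  proof -
    have "expectation (P i) = (expectation (\<lambda>\<omega>. (m (\<kappa> (Suc i)) \<omega>)\<^sup>2)
        + expectation (\<lambda>\<omega>. (D (Suc i) \<omega>)\<^sup>2)) / (real (Suc i))\<^sup>2"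
      unfolding P_def m_def
      by (simp only: integral_divide_zero Bochner_Integration.integral_add[OF M2(1) D_int])
    also have "\<dots> \<le> (V + (1 + a) * ((1 + a) * V0)) / (real (Suc i))\<^sup>2"
      unfolding m_def by (intro divide_right_mono add_mono M2(2) D_bound) auto
    finally show ?thesis by simp
  qed
  have "summable (\<lambda>i. expectation (P i))"
  proof (rule summable_comparison_test')
    have "summable (\<lambda>n. 1 / (real n)\<^sup>2)"
      using inverse_power_summable[of 2, where 'a = real] by (simp add: field_simps)
    then have "summable (\<lambda>n. 1 / (real (Suc n))\<^sup>2)"
      by (subst summable_Suc_iff)
    then show "summable (\<lambda>i. (V + (1 + a) * ((1 + a) * V0)) * (1 / (real (Suc i))\<^sup>2))"
      by (rule summable_mult)
    show "norm (expectation (P i)) \<le> (V + (1 + a) * ((1 + a) * V0)) * (1 / (real (Suc i))\<^sup>2)"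
      if "i \<ge> 0" for i
      using P_bound[of i] integral_nonneg_AE[of "P i" M] by (simp add: P_def)
  qed
  then have "AE \<omega> in M. (\<lambda>i. P i \<omega>) \<longlonglongrightarrow> 0"
    by (intro AE_tendsto_0_if_summable_integral P_int) (auto simp: P_def)
  then show ?thesis
  proof eventually_elim
    case (elim \<omega>)
    have "(\<lambda>k. m k \<omega> / s k) \<longlonglongrightarrow> 0"
    proof (rule LIMSEQ_I)
      fix e :: real assume e: "e > 0"
      then obtain I where I: "\<And>i. i \<ge> I \<Longrightarrow> P i \<omega> < (e / 2)\<^sup>2"
        using LIMSEQ_D[OF elim, of "(e / 2)\<^sup>2"] by (auto simp: abs_less_iff)
      have "norm (m k \<omega> / s k) < e" if k: "k \<ge> \<kappa> (Suc I)" for k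
      proof -
        \<comment> \<open>\<open>j\<close> numbers the block containing \<open>k\<close>, in the
          sense \<open>\<kappa> j \<le> k < \<kappa> (Suc j)\<close>. The start value and the
          absolute sum of the block each stay below \<open>e / 2 * j\<close>, and
          \<open>j \<le> s k\<close>.\<close>
        define j where "j = nat \<lfloor>s k\<rfloor>"
        have "s k \<ge> real (Suc I)" using s_mono[OF k] \<kappa>1[of "Suc I"] by linarith
        then have j: "j \<ge> Suc I" "real j \<le> s k" "s k < real (Suc j)"
          unfolding j_def by (auto simp: le_nat_floor) (linarith+)
        obtain i where i: "j = Suc i" "i \<ge> I" using j(1) by (cases j) auto
        have kj: "\<kappa> j \<le> k" using \<kappa>_le j(2) by blast
        have kj': "k < \<kappa> (Suc j)"
          using s_mono[of "\<kappa> (Suc j)" k] \<kappa>1[of "Suc j"] j(3) by force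
        have split: "{1..k} = {1..\<kappa> j} \<union> {\<kappa> j<..k}" using kj by auto
        have "m k \<omega> = m (\<kappa> j) \<omega> + (\<Sum>t\<in>{\<kappa> j<..k}. w t * N t \<omega>)"
          unfolding m_def split by (subst sum.union_disjoint) auto
        moreover have "\<bar>\<Sum>t\<in>{\<kappa> j<..k}. w t * N t \<omega>\<bar> \<le> (\<Sum>t\<in>{\<kappa> j<..k}. w t * \<bar>N t \<omega>\<bar>)"
          by (rule order_trans[OF sum_abs]) (simp add: abs_mult w)
        moreover have "(\<Sum>t\<in>{\<kappa> j<..k}. w t * \<bar>N t \<omega>\<bar>) \<le> D j \<omega>"
          unfolding D_def using kj' by (intro sum_mono2) (auto simp: w)
        ultimately have "\<bar>m k \<omega>\<bar> \<le> \<bar>m (\<kappa> j) \<omega>\<bar> + D j \<omega>" by linarith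
        moreover have P_lt: "(m (\<kappa> j) \<omega>)\<^sup>2 + (D j \<omega>)\<^sup>2 < (e / 2 * real j)\<^sup>2"
          using I[OF i(2)] unfolding power_mult_distrib
          by (simp add: P_def i(1) pos_divide_less_eq del: of_nat_Suc)
        have "\<bar>m (\<kappa> j) \<omega>\<bar> < e / 2 * real j"
          using P_lt e by (intro power2_less_imp_less[of "\<bar>m (\<kappa> j) \<omega>\<bar>"])
            (auto intro: le_less_trans[rotated])
        moreover have "D j \<omega> < e / 2 * real j"
          using P_lt e by (intro power2_less_imp_less[of "D j \<omega>"])
            (auto intro: le_less_trans[rotated])
        ultimately have "\<bar>m k \<omega>\<bar> < e * real j" by simp
        also have "\<dots> \<le> e * s k" using j(2) e by simp
        finally show ?thesis using j i by (simp add: abs_divide divide_less_eq)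
      qed
      then show "\<exists>n. \<forall>k\<ge>n. norm (m k \<omega> / s k - 0) < e" by auto
    qed
    then show ?case by (simp add: m_def s_def)
  qed
qed

section \<open>Independence expressed through sigma-algebras\<close>

lemma (in prob_space) indep_set_imp_indep_var:
  assumes indep: "indep_set (sets G) (sets H)" and sp: "space G = space M" "space H = space M"
    and V: "V \<in> measurable G T" and U: "U \<in> measurable H S"
  shows "indep_var T V S U"
proof -
  have sub: "sets G \<subseteq> events" "sets H \<subseteq> events"
    using indep unfolding indep_set_def indep_sets_def by (auto simp: UNIV_bool)
  have "random_variable T V" "random_variable S U"
    using measurable_mono[OF order_refl refl sub(1), of T] measurable_mono[OF order_refl refl sub(2), of S]
      sp U V by auto
  moreover have "sigma_sets (space G) {V -` A \<inter> space G |A. A \<in> sets T} \<subseteq> sets G"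
    using measurable_sets[OF V] by (intro sets.sigma_sets_subset) auto
  moreover have "sigma_sets (space H) {U -` A \<inter> space H |A. A \<in> sets S} \<subseteq> sets H"
    using measurable_sets[OF U] by (intro sets.sigma_sets_subset) auto
  ultimately show ?thesis
    unfolding indep_var_eq sp
    by (intro conjI indep_setI) (blast intro: indep_setD[OF indep] sub[THEN subsetD])+
qed

text \<open>The library notion \<open>indep_var\<close> forces both variables to have the same type, so independence of
  variables of different types is expressed through the generating \<open>\<sigma>\<close>-algebras.\<close>

lemma (in prob_space) distr_Pair_indep_set:
  assumes indep: "indep_set (sets G) (sets H)" and sp: "space G = space M" "space H = space M"
    and V: "V \<in> measurable G T" and U: "U \<in> measurable H S"
  shows "distr M S U \<Otimes>\<^sub>M distr M T V = distr M (S \<Otimes>\<^sub>M T) (\<lambda>w. (U w, V w))"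
proof -
  have sub: "sets G \<subseteq> events" "sets H \<subseteq> events"
    using indep unfolding indep_set_def indep_sets_def by (auto simp: UNIV_bool)
  have [measurable]: "random_variable T V" "random_variable S U"
    using measurable_mono[OF order_refl refl sub(1), of T] measurable_mono[OF order_refl refl sub(2), of S]
      sp U V by auto
  interpret U: prob_space "distr M S U" by (rule prob_space_distr) measurable
  interpret V: prob_space "distr M T V" by (rule prob_space_distr) measurable
  show ?thesis
  proof (rule pair_measure_eqI)
    fix A B assume "A \<in> sets (distr M S U)" "B \<in> sets (distr M T V)"
    then have [measurable]: "A \<in> sets S" "B \<in> sets T" by simp_all
    have "prob ((V -` B \<inter> space M) \<inter> (U -` A \<inter> space M))
        = prob (V -` B \<inter> space M) * prob (U -` A \<inter> space M)"
      using measurable_sets[OF V \<open>B \<in> sets T\<close>] measurable_sets[OF U \<open>A \<in> sets S\<close>] sp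
      by (intro indep_setD[OF indep]) auto
    moreover have "(V -` B \<inter> space M) \<inter> (U -` A \<inter> space M)
        = (\<lambda>w. (U w, V w)) -` (A \<times> B) \<inter> space M" by auto
    ultimately show "emeasure (distr M S U) A * emeasure (distr M T V) B
        = emeasure (distr M (S \<Otimes>\<^sub>M T) (\<lambda>w. (U w, V w))) (A \<times> B)"
      by (simp add: emeasure_distr emeasure_eq_measure ennreal_mult' mult.commute)
  qed (simp_all add: U.sigma_finite_measure_axioms V.sigma_finite_measure_axioms
      cong: sets_pair_measure_cong)
qed

text \<open>Stands in for conditioning on the past: Fubini on the product law freezes the past value
  \<open>U\<close>, so it suffices that the fresh variable \<open>V\<close> gives mean zero for
  every frozen value.\<close>

lemma (in prob_space) expectation_indep_eq_0:
  fixes h :: "_ \<Rightarrow> real"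
  assumes indep: "indep_set (sets G) (sets H)" and sp: "space G = space M" "space H = space M"
    and V: "V \<in> measurable G T" and U: "U \<in> measurable H S"
    and h [measurable]: "h \<in> borel_measurable (S \<Otimes>\<^sub>M T)"
    and int: "integrable M (\<lambda>w. h (U w, V w))"
    and zero: "\<And>u. u \<in> space S \<Longrightarrow> expectation (\<lambda>w. h (u, V w)) = 0"
  shows "expectation (\<lambda>w. h (U w, V w)) = 0"
proof -
  have sub: "sets G \<subseteq> events" "sets H \<subseteq> events"
    using indep unfolding indep_set_def indep_sets_def by (auto simp: UNIV_bool)
  have [measurable]: "random_variable T V" "random_variable S U"
    using measurable_mono[OF order_refl refl sub(1), of T] measurable_mono[OF order_refl refl sub(2), of S]
      sp U V by auto
  note eq = distr_Pair_indep_set[OF indep sp V U]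
  interpret U: prob_space "distr M S U" by (rule prob_space_distr) measurable
  interpret V: prob_space "distr M T V" by (rule prob_space_distr) measurable
  interpret UV: pair_sigma_finite "distr M S U" "distr M T V" ..
  have "integrable (distr M S U \<Otimes>\<^sub>M distr M T V) h"
    unfolding eq by (subst integrable_distr_eq) (auto intro: int)
  then have "integral\<^sup>L (distr M S U \<Otimes>\<^sub>M distr M T V) h
      = (\<integral>u. (\<integral>v. h (u, v) \<partial>distr M T V) \<partial>distr M S U)"
    by (rule UV.integral_fst'[symmetric])
  also have "\<dots> = (\<integral>u. 0 \<partial>distr M S U)"
    by (intro Bochner_Integration.integral_cong refl) (auto simp: integral_distr zero)
  finally have "integral\<^sup>L (distr M (S \<Otimes>\<^sub>M T) (\<lambda>x. (U x, V x))) h = 0"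
    unfolding eq by simp
  then show ?thesis by (subst (asm) integral_distr) auto
qed

section \<open>Consensus\<close>

text \<open>Orthogonal projection onto the complement of the all-ones vector: it maps the vector of
  the agents' values to their deviations from the mean.\<close>

abbreviation (input) centering_matrix :: "real^'m^'m" where
  "centering_matrix \<equiv> mat 1 - averaging_matrix"

lemma centering_matrix_mult:
  fixes x :: "real^'m"
  shows "centering_matrix *v x = (\<chi> i. x $ i - (\<Sum>j\<in>UNIV. x $ j) / CARD('m))"
  unfolding matrix_vector_mult_diff_rdistrib matrix_vector_mul_lid
  by (simp add: vec_eq_iff averaging_matrix_def matrix_vector_mult_def sum_divide_distrib)

lemma centering_matrix_idem:
  fixes x :: "real^'m"
  shows "centering_matrix *v (centering_matrix *v x) = centering_matrix *v x"
  by (simp add: centering_matrix_mult vec_eq_iff sum_subtractf)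

lemma centering_matrix_symmetric:
  fixes x y :: "real^'m"
  shows "(centering_matrix *v x) \<bullet> y = x \<bullet> (centering_matrix *v y)"
  unfolding centering_matrix_mult inner_vec_def inner_real_def vec_lambda_beta
    left_diff_distrib right_diff_distrib sum_subtractf
  by (simp flip: sum_distrib_left sum_distrib_right sum_divide_distrib)

lemma norm_centering_matrix_le:
  fixes x :: "real^'m"
  shows "norm (centering_matrix *v x) \<le> norm x"
proof -
  have "(norm (centering_matrix *v x))\<^sup>2 = x \<bullet> (centering_matrix *v x)"
    by (simp add: power2_norm_eq_inner centering_matrix_symmetric centering_matrix_idem)
  also have "\<dots> \<le> norm x * norm (centering_matrix *v x)" by (rule norm_cauchy_schwarz)
  finally show ?thesis
    by (cases "norm (centering_matrix *v x) = 0")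
       (simp_all add: power2_eq_square)
qed

text \<open>Row sums one make \<open>W\<close> fix constant vectors, and centering kills these; so
  the disagreement after mixing depends only on the disagreement before.\<close>

lemma centering_doubly_stochastic:
  fixes W :: "real^'m^'m"
  assumes "doubly_stochastic W"
  shows "centering_matrix *v (W *v x) = centering_matrix *v (W *v (centering_matrix *v x))"
proof -
  define r where "r = (\<Sum>j\<in>UNIV. x $ j) / CARD('m)"
  have x: "x = centering_matrix *v x + (\<chi> i. r)"
    by (simp add: vec_eq_iff centering_matrix_mult r_def)
  have "W *v (\<chi> i. r) = (\<chi> i. r)"
    using assms by (simp add: vec_eq_iff matrix_vector_mult_def doubly_stochastic_def
        flip: sum_distrib_right)
  moreover have "centering_matrix *v (\<chi> i. r) = (0 :: real^'m)"
    by (simp add: vec_eq_iff centering_matrix_mult)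
  ultimately show ?thesis
    using arg_cong[OF x, of "\<lambda>v. centering_matrix *v (W *v v)"]
    by (simp only: matrix_vector_right_distrib add.right_neutral)
qed

text \<open>Centering is symmetric and idempotent, so the squared norm becomes a quadratic form in
  exactly the matrix whose expectation carries the spectral hypothesis.\<close>

lemma norm_centering_mult_square:
  fixes W :: "real^'m^'m"
  shows "(norm (centering_matrix *v (W *v y)))\<^sup>2
    = y \<bullet> ((transpose W ** centering_matrix ** W) *v y)"
proof -
  have "(norm (centering_matrix *v (W *v y)))\<^sup>2 = (W *v y) \<bullet> (centering_matrix *v (W *v y))"
    by (simp add: power2_norm_eq_inner centering_matrix_symmetric centering_matrix_idem)
  also have "\<dots> = y \<bullet> (transpose W *v (centering_matrix *v (W *v y)))"
    by (metis dot_lmul_matrix inner_commute transpose_matrix_vector transpose_transpose)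
  finally show ?thesis by (simp add: matrix_vector_mul_assoc matrix_mul_assoc)
qed

lemma continuous_on_gram: "continuous_on UNIV (\<lambda>W :: real^'m^'m. transpose W ** centering_matrix ** W)"
  unfolding matrix_matrix_mult_def transpose_def
  by (intro continuous_intros)

lemma norm_doubly_stochastic_le:
  fixes W :: "real^'m^'m"
  assumes "doubly_stochastic W"
  shows "norm W \<le> CARD('m)"
proof -
  have "norm W \<le> (\<Sum>i\<in>UNIV. norm (W $ i))" 
    unfolding norm_vec_def[of W] by (rule L2_set_le_sum) simp
  also have "\<dots> \<le> (\<Sum>i\<in>(UNIV::'m set). 1)"
  proof (rule sum_mono)
    fix i
    have "norm (W $ i) \<le> (\<Sum>j\<in>UNIV. \<bar>W $ i $ j\<bar>)" by (rule norm_le_l1_cart)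
    also have "\<dots> = 1" using assms by (simp add: doubly_stochastic_def)
    finally show "norm (W $ i) \<le> 1" .
  qed
  finally show ?thesis by simp
qed

text \<open>Doubly stochastic matrices lie in a compact ball, on which the continuous Gram map is
  bounded.\<close>

lemma (in finite_measure) integrable_gram:
  fixes W :: "'a \<Rightarrow> real^'m^'m"
  assumes W: "W \<in> borel_measurable M" and ds: "AE \<omega> in M. doubly_stochastic (W \<omega>)"
  shows "integrable M (\<lambda>\<omega>. transpose (W \<omega>) ** centering_matrix ** W \<omega>)"
proof -
  let ?g = "\<lambda>W :: real^'m^'m. transpose W ** centering_matrix ** W"
  have "compact (?g ` cball 0 CARD('m))"
    by (intro compact_continuous_image continuous_on_subset[OF continuous_on_gram]) auto
  from compact_imp_bounded[OF this]
  obtain K where "\<forall>x \<in> ?g ` cball 0 CARD('m). norm x \<le> K"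
    unfolding bounded_iff ..
  then have K: "norm (?g W) \<le> K" if "W \<in> cball 0 CARD('m)" for W
    using that by blast
  show ?thesis
  proof (rule integrable_const_bound)
    show "AE \<omega> in M. norm (?g (W \<omega>)) \<le> K"
      using ds by eventually_elim (auto intro!: K norm_doubly_stochastic_le)
    show "(\<lambda>\<omega>. ?g (W \<omega>)) \<in> borel_measurable M"
      by (rule measurable_compose[OF W borel_measurable_continuous_onI[OF continuous_on_gram]])
  qed
qed

text \<open>Expanding the form into entries lets independence replace the random matrix by its mean.
  The contraction is thus one in mean square: no single matrix has to contract.\<close>

lemma (in prob_space) expectation_indep_quadratic_form:
  fixes P :: "'a \<Rightarrow> real^'m^'m" and y :: "'a \<Rightarrow> real^'m"
  assumes indep: "indep_set (sets G) (sets H)" and sp: "space G = space M" "space H = space M"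
    and P_meas: "P \<in> borel_measurable G" and y_meas: "y \<in> borel_measurable H"
    and P: "integrable M P" and y2: "integrable M (\<lambda>\<omega>. (norm (y \<omega>))\<^sup>2)"
  shows "integrable M (\<lambda>\<omega>. y \<omega> \<bullet> (P \<omega> *v y \<omega>))"
    and "expectation (\<lambda>\<omega>. y \<omega> \<bullet> (P \<omega> *v y \<omega>))
      \<le> spectral_norm (expectation P) * expectation (\<lambda>\<omega>. (norm (y \<omega>))\<^sup>2)"
proof -
  let ?W = "expectation P"
  have "sets H \<subseteq> events"
    using indep unfolding indep_set_def indep_sets_def by (auto simp: UNIV_bool)
  then have y [measurable]: "y \<in> borel_measurable M"
    using measurable_mono[OF order_refl refl _ sp(2)] y_meas by auto
  have comp [measurable]: "(\<lambda>\<omega>. y \<omega> $ i) \<in> borel_measurable M" for i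
    by (rule measurable_compose[OF y]) (intro borel_measurable_continuous_onI continuous_intros)
  have yy: "integrable M (\<lambda>\<omega>. y \<omega> $ i * y \<omega> $ j)" for i j
    by (rule Bochner_Integration.integrable_bound[OF y2])
       (auto simp: abs_mult power2_eq_square intro!: AE_I2 mult_mono component_le_norm_cart)
  have ent: "bounded_linear (\<lambda>W :: real^'m^'m. W $ i $ j)" for i j
    using bounded_linear_compose[OF bounded_linear_vec_nth bounded_linear_vec_nth] .
  have Pij: "integrable M (\<lambda>\<omega>. P \<omega> $ i $ j)" for i j
    by (rule integrable_bounded_linear[OF ent P])
  have EPij: "expectation (\<lambda>\<omega>. P \<omega> $ i $ j) = ?W $ i $ j" for i j
    by (rule integral_bounded_linear[OF ent P])
  have indep_ij: "indep_var borel (\<lambda>\<omega>. P \<omega> $ i $ j) borel (\<lambda>\<omega>. y \<omega> $ i * y \<omega> $ j)" for i j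
    by (rule indep_set_imp_indep_var[OF indep sp measurable_compose[OF P_meas]
          measurable_compose[OF y_meas]])
       (intro borel_measurable_continuous_onI continuous_intros linear_continuous_on ent)+
  have form: "y \<omega> \<bullet> (W *v y \<omega>) = (\<Sum>i\<in>UNIV. \<Sum>j\<in>UNIV. W $ i $ j * (y \<omega> $ i * y \<omega> $ j))" for W \<omega>
    by (simp add: inner_vec_def matrix_vector_mult_def sum_distrib_left mult.left_commute)
  have prod: "integrable M (\<lambda>\<omega>. P \<omega> $ i $ j * (y \<omega> $ i * y \<omega> $ j))" for i j
    by (rule indep_var_integrable[OF indep_ij Pij yy])
  then show "integrable M (\<lambda>\<omega>. y \<omega> \<bullet> (P \<omega> *v y \<omega>))"
    unfolding form by (intro Bochner_Integration.integrable_sum)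
  have "expectation (\<lambda>\<omega>. y \<omega> \<bullet> (P \<omega> *v y \<omega>))
      = (\<Sum>i\<in>UNIV. \<Sum>j\<in>UNIV. ?W $ i $ j * expectation (\<lambda>\<omega>. y \<omega> $ i * y \<omega> $ j))"
    unfolding form
    by (simp add: prod indep_var_lebesgue_integral[OF indep_ij Pij yy] EPij)
  also have "\<dots> = expectation (\<lambda>\<omega>. y \<omega> \<bullet> (?W *v y \<omega>))"
    unfolding form by (simp add: yy)
  also have "\<dots> \<le> expectation (\<lambda>\<omega>. spectral_norm ?W * (norm (y \<omega>))\<^sup>2)"
  proof (rule integral_mono)
    show "integrable M (\<lambda>\<omega>. y \<omega> \<bullet> (?W *v y \<omega>))"
      unfolding form by (intro Bochner_Integration.integrable_sum integrable_mult_right yy)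
    show "integrable M (\<lambda>\<omega>. spectral_norm ?W * (norm (y \<omega>))\<^sup>2)"
      by (intro integrable_mult_right y2)
    fix \<omega>
    have "y \<omega> \<bullet> (?W *v y \<omega>) \<le> norm (y \<omega>) * norm (?W *v y \<omega>)" by (rule norm_cauchy_schwarz)
    also have "\<dots> \<le> norm (y \<omega>) * (spectral_norm ?W * norm (y \<omega>))"
      unfolding spectral_norm_def by (intro mult_left_mono onorm) auto
    finally show "y \<omega> \<bullet> (?W *v y \<omega>) \<le> spectral_norm ?W * (norm (y \<omega>))\<^sup>2"
      by (simp add: power2_eq_square ac_simps)
  qed
  finally show "expectation (\<lambda>\<omega>. y \<omega> \<bullet> (P \<omega> *v y \<omega>))
      \<le> spectral_norm ?W * expectation (\<lambda>\<omega>. (norm (y \<omega>))\<^sup>2)" by simp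
qed

text \<open>Young's inequality with a free parameter: a small \<open>\<eta>\<close> keeps the factor
  of the first term close to 1, so that a contraction survives.\<close>

lemma norm_diff_square_le:
  fixes x y :: "'a::real_inner"
  assumes "\<eta> > 0"
  shows "(norm (x - y))\<^sup>2 \<le> (1 + \<eta>) * (norm x)\<^sup>2 + (1 + 1 / \<eta>) * (norm y)\<^sup>2"
proof -
  have "0 \<le> (norm (\<eta> *\<^sub>R x + y))\<^sup>2 / \<eta>" using assms by simp
  also have "\<dots> = \<eta> * (norm x)\<^sup>2 + 2 * (x \<bullet> y) + (norm y)\<^sup>2 / \<eta>"
    using assms by (simp add: power2_norm_eq_inner inner_add_left inner_add_right inner_commute[of y x])
      (simp add: field_simps)
  finally show ?thesis
    by (simp add: power2_norm_eq_inner inner_diff_left inner_diff_right inner_commute[of y x]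
        distrib_right)
qed

text \<open>Summing the recursion puts \<open>q\<close> times the partial sum on the right;
  absorbing it on the left bounds all partial sums by
  \<open>(e 0 + suminf r) / (1 - q)\<close>.\<close>

lemma summable_contractive_recursion:
  fixes e r :: "nat \<Rightarrow> real"
  assumes e: "\<And>t. 0 \<le> e t" and r: "summable r" "\<And>t. 0 \<le> r t" and q: "0 \<le> q" "q < 1"
    and rec: "\<And>t. e (Suc t) \<le> q * e t + r t"
  shows "summable e"
proof (rule bounded_imp_summable[OF e])
  fix n
  have "(\<Sum>t\<le>n. e t) \<le> e 0 + (\<Sum>t<n. e (Suc t))"
    by (simp add: sum.atMost_shift)
  also have "(\<Sum>t<n. e (Suc t)) \<le> (\<Sum>t<n. q * e t + r t)"
    by (intro sum_mono rec)
  also have "\<dots> = q * (\<Sum>t<n. e t) + (\<Sum>t<n. r t)"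
    by (simp add: sum.distrib sum_distrib_left)
  also have "\<dots> \<le> q * (\<Sum>t\<le>n. e t) + suminf r"
    using e r q by (intro add_mono mult_left_mono sum_mono2 sum_le_suminf) auto
  finally have "(1 - q) * (\<Sum>t\<le>n. e t) \<le> e 0 + suminf r"
    by (simp add: algebra_simps)
  then show "(\<Sum>t\<le>n. e t) \<le> (e 0 + suminf r) / (1 - q)"
    using q by (simp add: pos_le_divide_eq mult.commute)
qed

text \<open>The initial state need not be integrable, so second moments are taken on the event
  \<open>norm (u 0) \<le> n\<close>, which lies in every \<open>G t\<close>.\<close>

lemma (in prob_space) AE_consensus:
  fixes u \<gamma> :: "nat \<Rightarrow> 'a \<Rightarrow> real^'m" and W :: "nat \<Rightarrow> 'a \<Rightarrow> real^'m^'m"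
  assumes G: "\<And>t. space (G t) = space M"
    and u: "\<And>t. u t \<in> borel_measurable (G t)" "\<And>t. u 0 \<in> borel_measurable (G t)"
    and W: "\<And>t. W (Suc t) \<in> borel_measurable M"
    and fresh: "\<And>t. indep_set (gen_events M (W (Suc t)) borel) (sets (G t))"
    and ds: "\<And>t. AE \<omega> in M. doubly_stochastic (W (Suc t) \<omega>)"
    and contract: "\<And>t. spectral_norm
        (expectation (\<lambda>\<omega>. transpose (W (Suc t) \<omega>) ** centering_matrix ** W (Suc t) \<omega>)) \<le> \<rho>" "\<rho> < 1"
    and rec: "\<And>t \<omega>. \<omega> \<in> space M \<Longrightarrow>
        u (Suc t) \<omega> = W (Suc t) \<omega> *v u t \<omega> - s (Suc t) *\<^sub>R \<gamma> (Suc t) \<omega>"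
    and s: "summable (\<lambda>t. (s (Suc t))\<^sup>2)"
    and \<gamma>: "\<And>t. \<gamma> (Suc t) \<in> borel_measurable M"
      "\<And>t. integrable M (\<lambda>\<omega>. (norm (\<gamma> (Suc t) \<omega>))\<^sup>2)"
      "\<And>t. expectation (\<lambda>\<omega>. (norm (\<gamma> (Suc t) \<omega>))\<^sup>2) \<le> V"
  shows "AE \<omega> in M. (\<lambda>t. centering_matrix *v u t \<omega>) \<longlonglongrightarrow> 0"
proof -
  let ?J = "centering_matrix :: real^'m^'m"
  define P where "P = (\<lambda>t \<omega>. transpose (W (Suc t) \<omega>) ** ?J ** W (Suc t) \<omega>)"
  \<comment> \<open>With this choice \<open>(1 + \<eta>) * \<rho> \<le> \<rho> + \<eta> = (1 +
    \<rho>) / 2\<close>, which is \<open>q < 1\<close>.\<close>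
  define \<eta> where "\<eta> = (1 - \<rho>) / 2"
  define q where "q = (1 + \<rho>) / 2"
  define K where "K = 1 + 1 / \<eta>"
  have "0 \<le> spectral_norm (expectation (P 0))"
    unfolding spectral_norm_def by (intro onorm_pos_le) auto
  with contract(1)[of 0] have \<rho>: "0 \<le> \<rho>" by (simp add: P_def)
  have \<eta>: "\<eta> > 0" and q: "0 \<le> q" "q < 1" using contract(2) \<rho> by (simp_all add: \<eta>_def q_def)
  have K: "K \<ge> 0" using \<eta> by (simp add: K_def)
  have \<eta>\<rho>: "(1 + \<eta>) * \<rho> \<le> q"
  proof -
    have "\<eta> * \<rho> \<le> \<eta> * 1" using \<eta> contract(2) by (intro mult_left_mono) auto
    then show ?thesis by (simp add: \<eta>_def q_def field_simps)
  qed
  have sub: "sets (G t) \<subseteq> events" for t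
    using fresh[of t] unfolding indep_set_def indep_sets_def by (auto simp: UNIV_bool)
  have V: "0 \<le> V"
    by (rule order_trans[OF integral_nonneg_AE \<gamma>(3)[of 0]]) simp
  have P_int: "integrable M (P t)" for t
    unfolding P_def by (rule integrable_gram[OF W ds])
  have J_meas: "(\<lambda>v. ?J *v v) \<in> borel_measurable borel"
    by (intro borel_measurable_continuous_onI linear_continuous_on matrix_vector_mul_bounded_linear)
  have trunc: "AE \<omega> in M. norm (u 0 \<omega>) \<le> real n \<longrightarrow> (\<lambda>t. ?J *v u t \<omega>) \<longlonglongrightarrow> 0" for n
  proof -
    \<comment> \<open>The truncating factor does not depend on \<open>t\<close>, so it passes
      through the linear recursion; being a function of \<open>u 0\<close>, it keeps
      \<open>y t\<close> measurable for \<open>G t\<close> and hence independent of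
      \<open>W (Suc t)\<close>.\<close>
    define y where "y = (\<lambda>t \<omega>. indicator {\<omega>. norm (u 0 \<omega>) \<le> real n} \<omega> *\<^sub>R (?J *v u t \<omega>))"
    have y_meas: "y t \<in> borel_measurable (G t)" for t
    proof -
      note [measurable] = u measurable_compose[OF u(1)[of t] J_meas]
      show ?thesis unfolding y_def by measurable
    qed
    have [measurable]: "y t \<in> borel_measurable M" for t
      using measurable_mono[OF order_refl refl sub[of t] G[of t], of borel] y_meas by auto
    note \<gamma>(1)[measurable]
    have fresh': "indep_set (sets (vimage_algebra (space M) (W (Suc t)) borel)) (sets (G t))" for t
      using fresh[of t] by (simp add: gen_events_def)
    have P_meas: "P t \<in> borel_measurable (vimage_algebra (space M) (W (Suc t)) borel)" for t
      unfolding P_def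
      by (rule measurable_compose[OF measurable_vimage_algebra1
            borel_measurable_continuous_onI[OF continuous_on_gram]]) simp
    note quad = expectation_indep_quadratic_form[OF fresh' _ G P_meas y_meas P_int, simplified]
    have step: "AE \<omega> in M. (norm (y (Suc t) \<omega>))\<^sup>2
        \<le> (1 + \<eta>) * (y t \<omega> \<bullet> (P t \<omega> *v y t \<omega>)) + (K * (s (Suc t))\<^sup>2) * (norm (\<gamma> (Suc t) \<omega>))\<^sup>2" for t
      using ds[of t] AE_space
    proof eventually_elim
      case (elim \<omega>)
      define \<iota> where "\<iota> = (indicator {\<omega>. norm (u 0 \<omega>) \<le> real n} \<omega> :: real)"
      have \<iota>: "\<bar>\<iota>\<bar> \<le> 1" by (simp add: \<iota>_def indicator_def)
      have yt: "y t \<omega> = ?J *v (\<iota> *\<^sub>R u t \<omega>)" for t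
        by (simp add: y_def \<iota>_def matrix_vector_mult_scaleR)
      have "y (Suc t) \<omega> = ?J *v (W (Suc t) \<omega> *v (\<iota> *\<^sub>R u t \<omega>))
          - ?J *v (\<iota> *\<^sub>R s (Suc t) *\<^sub>R \<gamma> (Suc t) \<omega>)"
        unfolding yt rec[OF elim(2)]
        by (simp only: scaleR_right_diff_distrib matrix_vector_mult_diff_distrib
            matrix_vector_mult_scaleR)
      also have "?J *v (W (Suc t) \<omega> *v (\<iota> *\<^sub>R u t \<omega>)) = ?J *v (W (Suc t) \<omega> *v y t \<omega>)"
        unfolding yt by (rule centering_doubly_stochastic[OF elim(1)])
      finally have "(norm (y (Suc t) \<omega>))\<^sup>2
          \<le> (1 + \<eta>) * (norm (?J *v (W (Suc t) \<omega> *v y t \<omega>)))\<^sup>2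
            + K * (norm (?J *v (\<iota> *\<^sub>R s (Suc t) *\<^sub>R \<gamma> (Suc t) \<omega>)))\<^sup>2"
        unfolding K_def by (simp only: norm_diff_square_le[OF \<eta>])
      also have "(norm (?J *v (\<iota> *\<^sub>R s (Suc t) *\<^sub>R \<gamma> (Suc t) \<omega>)))\<^sup>2
          \<le> (\<bar>s (Suc t)\<bar> * norm (\<gamma> (Suc t) \<omega>))\<^sup>2"
        using norm_centering_matrix_le[of "\<iota> *\<^sub>R s (Suc t) *\<^sub>R \<gamma> (Suc t) \<omega>"]
          mult_right_mono[OF \<iota>, of "\<bar>s (Suc t)\<bar> * norm (\<gamma> (Suc t) \<omega>)"]
        by (intro power_mono) (simp_all add: abs_mult mult.assoc)
      finally show ?case
        using K by (simp add: norm_centering_mult_square P_def power_mult_distrib mult.assoc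
            mult_left_mono)
    qed
    have y2: "integrable M (\<lambda>\<omega>. (norm (y t \<omega>))\<^sup>2)" for t
    proof (induction t)
      case 0
      have "norm (y 0 \<omega>) \<le> real n" for \<omega>
        using norm_centering_matrix_le[of "u 0 \<omega>"] by (auto simp: y_def indicator_def)
      then show ?case
        by (intro integrable_const_bound[where B = "(real n)\<^sup>2"]) (auto simp: power_mono)
    next
      case (Suc t)
      show ?case
      proof (rule Bochner_Integration.integrable_bound)
        show "integrable M (\<lambda>\<omega>. (1 + \<eta>) * (y t \<omega> \<bullet> (P t \<omega> *v y t \<omega>))
            + (K * (s (Suc t))\<^sup>2) * (norm (\<gamma> (Suc t) \<omega>))\<^sup>2)"
          by (intro Bochner_Integration.integrable_add integrable_mult_right quad(1) Suc \<gamma>(2))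
        show "AE \<omega> in M. norm ((norm (y (Suc t) \<omega>))\<^sup>2)
            \<le> norm ((1 + \<eta>) * (y t \<omega> \<bullet> (P t \<omega> *v y t \<omega>))
              + (K * (s (Suc t))\<^sup>2) * (norm (\<gamma> (Suc t) \<omega>))\<^sup>2)"
          using step[of t] by eventually_elim simp
      qed measurable
    qed
    have rec_e: "expectation (\<lambda>\<omega>. (norm (y (Suc t) \<omega>))\<^sup>2)
        \<le> q * expectation (\<lambda>\<omega>. (norm (y t \<omega>))\<^sup>2) + K * V * (s (Suc t))\<^sup>2" for t
    proof -
      let ?e = "expectation (\<lambda>\<omega>. (norm (y t \<omega>))\<^sup>2)"
      have e: "0 \<le> ?e" by (rule integral_nonneg_AE) simp
      have "expectation (\<lambda>\<omega>. (norm (y (Suc t) \<omega>))\<^sup>2)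
          \<le> expectation (\<lambda>\<omega>. (1 + \<eta>) * (y t \<omega> \<bullet> (P t \<omega> *v y t \<omega>))
            + (K * (s (Suc t))\<^sup>2) * (norm (\<gamma> (Suc t) \<omega>))\<^sup>2)"
        by (intro integral_mono_AE y2 step Bochner_Integration.integrable_add integrable_mult_right
            quad(1) \<gamma>(2))
      also have "\<dots> = (1 + \<eta>) * expectation (\<lambda>\<omega>. y t \<omega> \<bullet> (P t \<omega> *v y t \<omega>))
          + (K * (s (Suc t))\<^sup>2) * expectation (\<lambda>\<omega>. (norm (\<gamma> (Suc t) \<omega>))\<^sup>2)"
        using quad(1)[OF y2] \<gamma>(2) by simp
      also have "\<dots> \<le> (1 + \<eta>) * (\<rho> * ?e) + (K * (s (Suc t))\<^sup>2) * V"
      proof (intro add_mono mult_left_mono \<gamma>(3))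
        show "expectation (\<lambda>\<omega>. y t \<omega> \<bullet> (P t \<omega> *v y t \<omega>)) \<le> \<rho> * ?e"
          by (rule order_trans[OF quad(2)[OF y2]])
             (use contract(1)[of t] e in \<open>auto simp: P_def intro!: mult_right_mono\<close>)
      qed (use \<eta> K in auto)
      also have "(1 + \<eta>) * (\<rho> * ?e) \<le> q * ?e"
        using mult_right_mono[OF \<eta>\<rho> e] by (simp add: mult.assoc)
      finally show ?thesis by (simp add: ac_simps)
    qed
    have "summable (\<lambda>t. expectation (\<lambda>\<omega>. (norm (y t \<omega>))\<^sup>2))"
      by (rule summable_contractive_recursion[OF _ summable_mult[OF s] _ q rec_e])
         (auto intro!: integral_nonneg_AE mult_nonneg_nonneg K V)
    then have "AE \<omega> in M. (\<lambda>t. (norm (y t \<omega>))\<^sup>2) \<longlonglongrightarrow> 0"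
      by (intro AE_tendsto_0_if_summable_integral y2) auto
    then show ?thesis
    proof eventually_elim
      case (elim \<omega>)
      then have "(\<lambda>t. sqrt ((norm (y t \<omega>))\<^sup>2)) \<longlonglongrightarrow> sqrt 0" by (intro tendsto_intros)
      then have "(\<lambda>t. y t \<omega>) \<longlonglongrightarrow> 0" by (simp add: tendsto_norm_zero_iff)
      then show ?case by (cases "norm (u 0 \<omega>) \<le> real n") (simp_all add: y_def)
    qed
  qed
  \<comment> \<open>The events \<open>norm (u 0 \<omega>) \<le> real n\<close> exhaust the space,
    and only countably many null sets are discarded.\<close>
  have "AE \<omega> in M. \<forall>n. norm (u 0 \<omega>) \<le> real n \<longrightarrow> (\<lambda>t. ?J *v u t \<omega>) \<longlonglongrightarrow> 0"
    unfolding AE_all_countable using trunc by blast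
  then show ?thesis
    by eventually_elim (use real_arch_simple in blast)
qed

section \<open>The iteration\<close>

lemma measurable_if_gen_events_subset:
  assumes "\<And>w. w \<in> space M \<Longrightarrow> Y w \<in> space N" "gen_events M Y N \<subseteq> sets G" "space G = space M"
  shows "Y \<in> measurable G N"
proof (rule measurableI)
  show "Y w \<in> space N" if "w \<in> space G" for w using assms(1,3) that by simp
  show "Y -` B \<inter> space G \<in> sets G" if "B \<in> sets N" for B
    using assms(2) in_vimage_algebra[OF that, of Y "space M"] assms(3)
    by (auto simp: gen_events_def)
qed

lemma gen_events_subset_Pow: "gen_events M Y N \<subseteq> Pow (space M)"
  unfolding gen_events_def using sets.space_closed[of "vimage_algebra (space M) Y N"] by simp

lemma space_history [simp]: "space (history M S z0 A \<zeta> k) = space M"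
  by (simp add: history_def space_measure_of_conv)

lemma gen_events_subset_history:
  "gen_events M (z0 j) borel \<subseteq> sets (history M S z0 A \<zeta> k)"
  "t \<in> {1..<k} \<Longrightarrow> gen_events M (\<zeta> j t) (S j) \<subseteq> sets (history M S z0 A \<zeta> k)"
  "t \<in> {1..<k} \<Longrightarrow> gen_events M (A t) borel \<subseteq> sets (history M S z0 A \<zeta> k)"
proof -
  let ?E = "(\<Union>j. gen_events M (z0 j) borel) \<union>
      (\<Union>t\<in>{1..<k}. (\<Union>j. gen_events M (\<zeta> j t) (S j)) \<union> gen_events M (A t) borel)"
  have "?E \<subseteq> Pow (space M)" by (intro Un_least UN_least gen_events_subset_Pow)
  then have "?E \<subseteq> sets (history M S z0 A \<zeta> k)"
    unfolding history_def by (auto simp: sets_measure_of)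
  then show "gen_events M (z0 j) borel \<subseteq> sets (history M S z0 A \<zeta> k)"
    "t \<in> {1..<k} \<Longrightarrow> gen_events M (\<zeta> j t) (S j) \<subseteq> sets (history M S z0 A \<zeta> k)"
    "t \<in> {1..<k} \<Longrightarrow> gen_events M (A t) borel \<subseteq> sets (history M S z0 A \<zeta> k)"
    by blast+
qed

lemma borel_measurable_Q_map:
  fixes X :: "'a::euclidean_space set"
  assumes "convex X" "closed X" "X \<noteq> {}"
  shows "Q_map X \<in> borel_measurable borel"
proof -
  have "Q_map X = closest_point X"
    using Q_map_eq_closest_point[OF assms] by auto
  then show ?thesis
    using borel_measurable_continuous_onI[OF continuous_on_closest_point[OF assms]] by simp
qed

text \<open>Stated for an arbitrary \<open>N\<close> making the data up to time \<open>k\<close>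
  measurable, so that the history in place of \<open>N\<close> yields adaptedness.\<close>

lemma borel_measurable_dual_iter:
  fixes F :: "'m::finite \<Rightarrow> real^'d \<Rightarrow> 'e \<Rightarrow> real"
  assumes X: "convex X" "closed X" "X \<noteq> {}"
    and F: "\<And>j x. F j x \<in> borel_measurable (S j)"
    and diff: "\<And>j s x. s \<in> space (S j) \<Longrightarrow> x \<in> X \<Longrightarrow> (\<lambda>y. F j y s) differentiable (at x)"
    and z0: "\<And>j. z0 j \<in> borel_measurable N"
    and A: "\<And>t. t \<in> {1..k} \<Longrightarrow> A t \<in> borel_measurable N"
    and \<zeta>: "\<And>j t. t \<in> {1..k} \<Longrightarrow> \<zeta> j t \<in> measurable N (S j)"
  shows "t \<le> k \<Longrightarrow> dual_iter X F s z0 A \<zeta> t j \<in> borel_measurable N"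
proof (induction t arbitrary: j)
  case 0
  then show ?case by (simp add: z0)
next
  case (Suc t)
  have t: "Suc t \<in> {1..k}" using Suc.prems by simp
  have z: "dual_iter X F s z0 A \<zeta> t i \<in> borel_measurable N" for i using Suc by simp
  have [measurable]: "(\<lambda>\<omega>. A (Suc t) \<omega> $ j $ i) \<in> borel_measurable N" for i
    by (rule measurable_compose[OF A[OF t]])
       (intro borel_measurable_continuous_onI continuous_intros)
  have QX: "Q_map X v \<in> X" for v
    using X closest_point_in_set by (simp add: Q_map_eq_closest_point)
  have [measurable]: "(\<lambda>\<omega>. gradient (\<lambda>y. F j y (\<zeta> j (Suc t) \<omega>)) (Q_map X (dual_iter X F s z0 A \<zeta> t j \<omega>)))
      \<in> borel_measurable N"
    by (rule borel_measurable_gradient[OF F \<zeta>[OF t]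
          measurable_compose[OF z borel_measurable_Q_map[OF X]]])
       (use measurable_space[OF \<zeta>[OF t]] QX in \<open>auto intro!: diff\<close>)
  note z[measurable]
  show ?case by simp
qed

lemma filterlim_sum_at_top:
  fixes w :: "nat \<Rightarrow> real"
  assumes "\<And>t. 0 \<le> w t" "\<not> summable w"
  shows "filterlim (\<lambda>k. \<Sum>t=1..k. w t) at_top sequentially"
  unfolding filterlim_at_top
proof
  fix Z
  have "\<not> (\<forall>k. (\<Sum>t\<le>k. w t) \<le> w 0 + Z)"
    using bounded_imp_summable[of w "w 0 + Z"] assms by blast
  then obtain k where k: "(\<Sum>t\<le>k. w t) > w 0 + Z" by (auto simp: not_le)
  have "Z \<le> (\<Sum>t=1..n. w t)" if "n \<ge> k" for n
  proof -
    have "(\<Sum>t\<le>k. w t) \<le> (\<Sum>t\<le>n. w t)" using that assms(1) by (intro sum_mono2) auto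
    also have "(\<Sum>t\<le>n. w t) = w 0 + (\<Sum>t=1..n. w t)"
      by (simp add: sum.atMost_shift sum.atLeast1_atMost_eq)
    finally show ?thesis using k by simp
  qed
  then show "eventually (\<lambda>k. Z \<le> (\<Sum>t=1..k. w t)) sequentially"
    by (rule eventually_sequentiallyI)
qed

text \<open>Pointwise domination by \<open>1 + f x powr p\<close>: the square is at most 1 where
  \<open>f x \<le> 1\<close>, and at most the higher power elsewhere.\<close>

lemma (in finite_measure) square_integrable_if_powr_integrable:
  fixes f :: "'a \<Rightarrow> real"
  assumes "f \<in> borel_measurable M" "\<And>x. x \<in> space M \<Longrightarrow> 0 \<le> f x" "p \<ge> 2"
    and "integrable M (\<lambda>x. f x powr p)"
  shows "integrable M (\<lambda>x. (f x)\<^sup>2)"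
proof (rule Bochner_Integration.integrable_bound)
  show "integrable M (\<lambda>x. 1 + f x powr p)" using assms by simp
  show "(\<lambda>x. (f x)\<^sup>2) \<in> borel_measurable M" using assms(1) by measurable
  show "AE x in M. norm ((f x)\<^sup>2) \<le> norm (1 + f x powr p)"
  proof (rule AE_I2)
    fix x assume "x \<in> space M"
    then have f: "0 \<le> f x" using assms by simp
    have "(f x)\<^sup>2 \<le> 1 + f x powr p"
    proof (cases "f x \<le> 1")
      case True
      then have "(f x)\<^sup>2 \<le> 1" using f by (simp add: power_le_one)
      then show ?thesis by (simp add: add_increasing2)
    next
      case False
      then have "(f x)\<^sup>2 = f x powr 2" by simp
      also have "\<dots> \<le> f x powr p" using False assms(3) by (intro powr_mono) auto
      finally show ?thesis by simp
    qed
    then show "norm ((f x)\<^sup>2) \<le> norm (1 + f x powr p)" by simp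
  qed
qed

text \<open>A fresh sample gives a gradient error of mean zero for each fixed past, so the weighted
  error sums have orthogonal increments and second moment at most \<open>V0\<close> times the sum of
  squared weights; the block argument does the rest.\<close>

lemma (in prob_space) AE_sampling_noise_average:
  fixes F :: "real^'d \<Rightarrow> 'e \<Rightarrow> real" and z :: "nat \<Rightarrow> 'a \<Rightarrow> real^'d" and i :: 'd
    and \<xi> :: "'a \<Rightarrow> 'e"
  defines "g \<equiv> \<lambda>x e. gradient (\<lambda>y. F y e) x"
  defines "gbar \<equiv> \<lambda>x. expectation (\<lambda>\<omega>. g x (\<xi> \<omega>))"
  assumes X: "convex X" "closed X" "X \<noteq> {}"
    and F: "\<And>x. F x \<in> borel_measurable T"
    and diff: "\<And>e x. e \<in> space T \<Longrightarrow> x \<in> X \<Longrightarrow> (\<lambda>y. F y e) differentiable (at x)"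
    and bound: "\<And>e x. e \<in> space T \<Longrightarrow> x \<in> X \<Longrightarrow> norm (g x e) \<le> l e"
    and l: "l \<in> borel_measurable T" "integrable M (\<lambda>\<omega>. (l (\<xi> \<omega>))\<^sup>2)"
    and \<xi>: "\<xi> \<in> measurable M T"
    and distr: "\<And>t. distr M T (\<zeta> (Suc t)) = distr M T \<xi>"
    and G: "\<And>t. space (G t) = space M"
    and z: "\<And>t r. r \<le> t \<Longrightarrow> z r \<in> borel_measurable (G t)"
    and \<zeta>: "\<And>t r. r \<in> {1..t} \<Longrightarrow> \<zeta> r \<in> measurable (G t) T"
    and \<zeta>_rv: "\<And>t. \<zeta> (Suc t) \<in> measurable M T"
    and fresh: "\<And>t. indep_set (gen_events M (\<zeta> (Suc t)) T) (sets (G t))"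
    and w: "\<And>t. 0 \<le> w t" "\<And>t. w t \<le> a" "summable (\<lambda>t. (w t)\<^sup>2)"
      "filterlim (\<lambda>k. \<Sum>t=1..k. w t) at_top sequentially"
  shows "AE \<omega> in M. (\<lambda>k. (\<Sum>t=1..k. w t * (g (Q_map X (z (t - 1) \<omega>)) (\<zeta> t \<omega>)
      - gbar (Q_map X (z (t - 1) \<omega>))) $ i) / (\<Sum>t=1..k. w t)) \<longlonglongrightarrow> 0"
proof -
  define d where "d = (\<lambda>v e. (g (Q_map X v) e - gbar (Q_map X v)) $ i)"
  \<comment> \<open>Index 0 is set to 0 because noise starts at time 1: \<open>\<zeta> 0\<close>
    carries no information, and \<open>t - 1\<close> would be truncated.\<close>
  define n where "n = (\<lambda>t \<omega>. if t = 0 then 0 else d (z (t - 1) \<omega>) (\<zeta> t \<omega>))"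
  have QX: "Q_map X v \<in> X" for v
    using X closest_point_in_set by (simp add: Q_map_eq_closest_point)
  have Q_meas [measurable]: "Q_map X \<in> borel_measurable borel"
    by (rule borel_measurable_Q_map[OF X])
  note l(1)[measurable] \<xi>[measurable] \<zeta>_rv[measurable]
  have nth: "(\<lambda>v::real^'d. v $ i) \<in> borel_measurable borel"
    by (intro borel_measurable_continuous_onI continuous_intros)
  have g_meas: "(\<lambda>\<omega>. g (Q_map X (v \<omega>)) (e \<omega>)) \<in> borel_measurable N"
    if "v \<in> borel_measurable N" "e \<in> measurable N T" for v e and N :: "'z measure"
    unfolding g_def
    by (rule borel_measurable_gradient[OF F that(2) measurable_compose[OF that(1) Q_meas]])
       (use measurable_space[OF that(2)] QX in \<open>auto intro!: diff\<close>)
  interpret D: prob_space "distr M T \<xi>" by (rule prob_space_distr) measurable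
  have l_nonneg: "0 \<le> l e" if "e \<in> space T" for e
    using bound[OF that QX] norm_ge_zero order_trans by blast
  have l_int: "integrable M (\<lambda>\<omega>. l (\<xi> \<omega>))"
    by (rule square_integrable_imp_integrable[OF _ l(2)]) measurable
  have gbar_distr: "gbar x = (\<integral>e. g x e \<partial>distr M T \<xi>)" if "x \<in> X" for x
  proof -
    have "g x \<in> borel_measurable T"
      unfolding g_def
      by (rule borel_measurable_gradient[OF F]) (use diff that in auto)
    then show ?thesis unfolding gbar_def by (subst integral_distr) auto
  qed
  \<comment> \<open>The mean gradient is a parameter integral of a jointly measurable integrand
    against the law of \<open>\<xi>\<close>.\<close>
  have gbar_meas [measurable]: "(\<lambda>v. gbar (Q_map X v)) \<in> borel_measurable borel"
  proof -
    have "(\<lambda>p. g (Q_map X (fst p)) (snd p)) \<in> borel_measurable (borel \<Otimes>\<^sub>M distr M T \<xi>)"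
      by (rule g_meas) measurable
    then have "(\<lambda>v. \<integral>e. g (Q_map X v) e \<partial>distr M T \<xi>) \<in> borel_measurable borel"
      by (intro D.borel_measurable_lebesgue_integral) (simp add: case_prod_beta')
    then show ?thesis by (simp add: gbar_distr QX)
  qed
  have gbar_le: "norm (gbar x) \<le> expectation (\<lambda>\<omega>. l (\<xi> \<omega>))" if "x \<in> X" for x
    unfolding gbar_def
    by (rule order_trans[OF integral_norm_bound integral_mono_AE'])
       (use l_int bound[OF measurable_space[OF \<xi>] that] l_nonneg[OF measurable_space[OF \<xi>]] in auto)
  define m1 where "m1 = expectation (\<lambda>\<omega>. l (\<xi> \<omega>))"
  have d_le: "\<bar>d v e\<bar> \<le> l e + m1" if "e \<in> space T" for v e
  proof -
    have "\<bar>d v e\<bar> \<le> norm (g (Q_map X v) e - gbar (Q_map X v))"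
      unfolding d_def by (rule component_le_norm_cart)
    also have "\<dots> \<le> norm (g (Q_map X v) e) + norm (gbar (Q_map X v))" by (rule norm_triangle_ineq4)
    finally show ?thesis using bound[OF that QX[of v]] gbar_le[OF QX[of v]] by (simp add: m1_def)
  qed
  have d2_le: "(d v e)\<^sup>2 \<le> 2 * (l e)\<^sup>2 + 2 * m1\<^sup>2" if "e \<in> space T" for v e
  proof -
    have "(d v e)\<^sup>2 \<le> (l e + m1)\<^sup>2"
      using d_le[OF that] by (metis abs_ge_zero power2_abs power_mono)
    also have "\<dots> \<le> 2 * (l e)\<^sup>2 + 2 * m1\<^sup>2"
      using sum_squares_bound[of "l e" m1] by (simp add: power2_sum)
    finally show ?thesis .
  qed
  have d_meas: "(\<lambda>\<omega>. d (v \<omega>) (e \<omega>)) \<in> borel_measurable N"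
    if [measurable]: "v \<in> borel_measurable N" "e \<in> measurable N T" for v e and N :: "'z measure"
    unfolding d_def
    by (intro measurable_compose[OF _ nth] borel_measurable_diff g_meas that
        measurable_compose[OF that(1) gbar_meas])
  have sub: "sets (G t) \<subseteq> events" for t
    using fresh[of t] unfolding indep_set_def indep_sets_def by (auto simp: UNIV_bool)
  have G_le: "v \<in> measurable M N" if "v \<in> measurable (G t) N" for t v and N :: "'z measure"
    using measurable_mono[OF order_refl refl sub[of t] G[of t], of N] that by auto
  have z_rv [measurable]: "z t \<in> borel_measurable M" for t
    by (rule G_le[OF z[OF order_refl]])
  have n_meas [measurable]: "n t \<in> borel_measurable M" for t
    unfolding n_def by (cases t) (auto intro!: d_meas)
  have l2: "integrable M (\<lambda>\<omega>. (l (\<zeta> (Suc t) \<omega>))\<^sup>2)"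
    "expectation (\<lambda>\<omega>. (l (\<zeta> (Suc t) \<omega>))\<^sup>2) = expectation (\<lambda>\<omega>. (l (\<xi> \<omega>))\<^sup>2)" for t
  proof -
    have "integrable (distr M T (\<zeta> (Suc t))) (\<lambda>e. (l e)\<^sup>2)"
      unfolding distr using l(2) by (subst integrable_distr_eq) auto
    then show "integrable M (\<lambda>\<omega>. (l (\<zeta> (Suc t) \<omega>))\<^sup>2)"
      by (subst (asm) integrable_distr_eq) auto
    have "(\<integral>e. (l e)\<^sup>2 \<partial>distr M T (\<zeta> (Suc t))) = (\<integral>e. (l e)\<^sup>2 \<partial>distr M T \<xi>)"
      by (simp add: distr)
    then show "expectation (\<lambda>\<omega>. (l (\<zeta> (Suc t) \<omega>))\<^sup>2) = expectation (\<lambda>\<omega>. (l (\<xi> \<omega>))\<^sup>2)"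
      by (simp add: integral_distr)
  qed
  \<comment> \<open>Comes from bounding the error by \<open>l e + m1\<close> and the square of this
    sum by twice the sum of squares; equal laws of the samples make it uniform in time.\<close>
  define V0 where "V0 = 2 * expectation (\<lambda>\<omega>. (l (\<xi> \<omega>))\<^sup>2) + 2 * m1\<^sup>2"
  have V0: "0 \<le> V0" unfolding V0_def by (intro add_nonneg_nonneg) (auto intro: integral_nonneg_AE)
  have n2_int: "integrable M (\<lambda>\<omega>. (n t \<omega>)\<^sup>2)" for t
  proof (cases t)
    case 0
    then show ?thesis by (simp add: n_def)
  next
    case (Suc t')
    show ?thesis
    proof (rule Bochner_Integration.integrable_bound)
      show "integrable M (\<lambda>\<omega>. 2 * (l (\<zeta> (Suc t') \<omega>))\<^sup>2 + 2 * m1\<^sup>2)" using l2(1) by simp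
      show "AE \<omega> in M. norm ((n t \<omega>)\<^sup>2) \<le> norm (2 * (l (\<zeta> (Suc t') \<omega>))\<^sup>2 + 2 * m1\<^sup>2)"
        using d2_le[OF measurable_space[OF \<zeta>_rv]] by (intro AE_I2) (auto simp: n_def Suc)
    qed measurable
  qed
  have n2_le: "expectation (\<lambda>\<omega>. (n t \<omega>)\<^sup>2) \<le> V0" for t
  proof (cases t)
    case 0
    then show ?thesis using V0 by (simp add: n_def)
  next
    case (Suc t')
    have "expectation (\<lambda>\<omega>. (n t \<omega>)\<^sup>2) \<le> expectation (\<lambda>\<omega>. 2 * (l (\<zeta> (Suc t') \<omega>))\<^sup>2 + 2 * m1\<^sup>2)"
      by (rule integral_mono[OF n2_int])
         (use l2(1) d2_le[OF measurable_space[OF \<zeta>_rv]] in \<open>auto simp: n_def Suc\<close>)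
    also have "\<dots> = V0" using l2 by (simp add: V0_def prob_space)
    finally show ?thesis .
  qed
  define m where "m = (\<lambda>k \<omega>. \<Sum>t=1..k. w t * n t \<omega>)"
  have m_Suc: "m (Suc k) \<omega> = m k \<omega> + w (Suc k) * n (Suc k) \<omega>" for k \<omega>
    by (simp add: m_def)
  have m_meas: "m k \<in> borel_measurable (G k)" for k
    unfolding m_def n_def
    by (intro borel_measurable_sum borel_measurable_times) (auto intro!: d_meas z \<zeta>)
  have [measurable]: "m k \<in> borel_measurable M" for k by (rule G_le[OF m_meas])
  have prod_int: "integrable M (\<lambda>\<omega>. m k \<omega> * n (Suc k) \<omega>)" if "integrable M (\<lambda>\<omega>. (m k \<omega>)\<^sup>2)" for k
  proof (rule Bochner_Integration.integrable_bound[where f = "\<lambda>\<omega>. (m k \<omega>)\<^sup>2 + (n (Suc k) \<omega>)\<^sup>2"])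
    show "AE \<omega> in M. norm (m k \<omega> * n (Suc k) \<omega>) \<le> norm ((m k \<omega>)\<^sup>2 + (n (Suc k) \<omega>)\<^sup>2)"
    proof (rule AE_I2)
      fix \<omega>
      show "norm (m k \<omega> * n (Suc k) \<omega>) \<le> norm ((m k \<omega>)\<^sup>2 + (n (Suc k) \<omega>)\<^sup>2)"
      proof -
        have "2 * (\<bar>m k \<omega>\<bar> * \<bar>n (Suc k) \<omega>\<bar>) \<le> (m k \<omega>)\<^sup>2 + (n (Suc k) \<omega>)\<^sup>2"
          using sum_squares_bound[of "\<bar>m k \<omega>\<bar>" "\<bar>n (Suc k) \<omega>\<bar>"] by (simp add: mult.assoc)
        moreover have "0 \<le> \<bar>m k \<omega>\<bar> * \<bar>n (Suc k) \<omega>\<bar>" by simp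
        ultimately have "\<bar>m k \<omega>\<bar> * \<bar>n (Suc k) \<omega>\<bar> \<le> (m k \<omega>)\<^sup>2 + (n (Suc k) \<omega>)\<^sup>2" by linarith
        then show ?thesis by (simp add: abs_mult)
      qed
    qed
  qed (use that n2_int in auto)
  have orth: "expectation (\<lambda>\<omega>. m k \<omega> * n (Suc k) \<omega>) = 0" if "integrable M (\<lambda>\<omega>. (m k \<omega>)\<^sup>2)" for k
  proof -
    \<comment> \<open>The past enters as the pair of \<open>m k\<close> and \<open>z k\<close>: with
      both frozen, \<open>h\<close> is a constant times a coordinate of a centred gradient
      error.\<close>
    define h where "h = (\<lambda>p. fst (fst p) * d (snd (fst p)) (snd p))"
    have fresh': "indep_set (sets (vimage_algebra (space M) (\<zeta> (Suc k)) T)) (sets (G k))"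
      using fresh[of k] by (simp add: gen_events_def)
    have "expectation (\<lambda>\<omega>. h ((m k \<omega>, z k \<omega>), \<zeta> (Suc k) \<omega>)) = 0"
    proof (rule expectation_indep_eq_0[OF fresh' _ G])
      show "\<zeta> (Suc k) \<in> measurable (vimage_algebra (space M) (\<zeta> (Suc k)) T) T"
        using measurable_space[OF \<zeta>_rv] by (intro measurable_vimage_algebra1) auto
      show "(\<lambda>\<omega>. (m k \<omega>, z k \<omega>)) \<in> measurable (G k) (borel \<Otimes>\<^sub>M borel)"
        by (intro measurable_Pair m_meas z order_refl)
      show "h \<in> borel_measurable ((borel \<Otimes>\<^sub>M borel) \<Otimes>\<^sub>M T)"
        unfolding h_def by (intro borel_measurable_times d_meas) measurable
      show "integrable M (\<lambda>\<omega>. h ((m k \<omega>, z k \<omega>), \<zeta> (Suc k) \<omega>))"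
        using prod_int[OF that] by (simp add: h_def n_def)
      fix u :: "real \<times> (real^'d)"
      let ?x = "Q_map X (snd u)"
      have gx: "g ?x \<in> borel_measurable T"
        using g_meas[of "\<lambda>_. snd u" T "\<lambda>e. e"] by simp
      have int_l: "integrable M (\<lambda>\<omega>. l (\<zeta> (Suc k) \<omega>))"
        by (rule square_integrable_imp_integrable[OF _ l2(1)]) measurable
      have int_g: "integrable M (\<lambda>\<omega>. g ?x (\<zeta> (Suc k) \<omega>))"
        by (rule Bochner_Integration.integrable_bound[OF int_l])
           (use measurable_compose[OF \<zeta>_rv gx] bound[OF measurable_space[OF \<zeta>_rv] QX]
             l_nonneg[OF measurable_space[OF \<zeta>_rv]] in auto)
      have "expectation (\<lambda>\<omega>. g ?x (\<zeta> (Suc k) \<omega>)) = (\<integral>e. g ?x e \<partial>distr M T (\<zeta> (Suc k)))"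
        using gx by (subst integral_distr) auto
      also have "\<dots> = gbar ?x" by (simp add: distr gbar_distr QX)
      finally have "expectation (\<lambda>\<omega>. g ?x (\<zeta> (Suc k) \<omega>) - gbar ?x) = 0"
        using int_g by (simp add: prob_space)
      moreover have "expectation (\<lambda>\<omega>. (g ?x (\<zeta> (Suc k) \<omega>) - gbar ?x) $ i)
          = expectation (\<lambda>\<omega>. g ?x (\<zeta> (Suc k) \<omega>) - gbar ?x) $ i"
        using int_g by (intro integral_bounded_linear[OF bounded_linear_vec_nth]) simp
      ultimately show "expectation (\<lambda>\<omega>. h (u, \<zeta> (Suc k) \<omega>)) = 0"
        by (simp add: h_def d_def)
    qed simp
    then show ?thesis by (simp add: h_def n_def)
  qed
  have m2: "integrable M (\<lambda>\<omega>. (m k \<omega>)\<^sup>2)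
      \<and> expectation (\<lambda>\<omega>. (m k \<omega>)\<^sup>2) \<le> (\<Sum>t\<in>{1..k}. (w t)\<^sup>2) * V0" for k
  proof (induction k)
    case 0
    then show ?case by (simp add: m_def)
  next
    case (Suc k)
    then have mk: "integrable M (\<lambda>\<omega>. (m k \<omega>)\<^sup>2)" by simp
    have eq: "(m (Suc k) \<omega>)\<^sup>2
        = (m k \<omega>)\<^sup>2 + 2 * w (Suc k) * (m k \<omega> * n (Suc k) \<omega>) + (w (Suc k))\<^sup>2 * (n (Suc k) \<omega>)\<^sup>2" for \<omega>
      by (simp add: m_Suc power2_sum power_mult_distrib)
    have "expectation (\<lambda>\<omega>. (m (Suc k) \<omega>)\<^sup>2)
        = expectation (\<lambda>\<omega>. (m k \<omega>)\<^sup>2) + (w (Suc k))\<^sup>2 * expectation (\<lambda>\<omega>. (n (Suc k) \<omega>)\<^sup>2)"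
      unfolding eq using mk prod_int[OF mk] n2_int orth[OF mk] by simp
    also have "\<dots> \<le> (\<Sum>t\<in>{1..k}. (w t)\<^sup>2) * V0 + (w (Suc k))\<^sup>2 * V0"
      using Suc by (intro add_mono mult_left_mono n2_le) auto
    finally show ?case
      using mk prod_int[OF mk] n2_int by (simp add: eq distrib_right)
  qed
  have "expectation (\<lambda>\<omega>. (m k \<omega>)\<^sup>2) \<le> (\<Sum>t. (w t)\<^sup>2) * V0" for k
    using m2[of k] sum_le_suminf[OF w(3), of "{1..k}"] V0
    by (auto intro: order_trans mult_right_mono)
  then have "AE \<omega> in M. (\<lambda>k. (\<Sum>t=1..k. w t * n t \<omega>) / (\<Sum>t=1..k. w t)) \<longlonglongrightarrow> 0"
    using m2 by (intro AE_weighted_average_tendsto_0[OF w(1,2,4) n_meas n2_int n2_le])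
      (auto simp: m_def)
  moreover have "(\<Sum>t=1..k. w t * n t \<omega>) = (\<Sum>t=1..k. w t * (g (Q_map X (z (t - 1) \<omega>)) (\<zeta> t \<omega>)
      - gbar (Q_map X (z (t - 1) \<omega>))) $ i)" for k \<omega>
    by (intro sum.cong) (auto simp: n_def d_def)
  ultimately show ?thesis by simp
qed

theorem lemma2:
  fixes M :: "'w measure"
    and S :: "'m::finite \<Rightarrow> 'e measure"
    and \<xi> :: "'m \<Rightarrow> 'w \<Rightarrow> 'e"
    and \<zeta> :: "'m \<Rightarrow> nat \<Rightarrow> 'w \<Rightarrow> 'e"
    and F :: "'m \<Rightarrow> real^'d \<Rightarrow> 'e \<Rightarrow> real"
    and L0 :: "'m \<Rightarrow> 'e \<Rightarrow> real"
    and B :: "real^'d^'p" and b :: "real^'p"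
    and C :: "real^'d^'q" and c :: "real^'q"
    and X :: "(real^'d) set"
    and fj :: "'m \<Rightarrow> real^'d \<Rightarrow> real" and f :: "real^'d \<Rightarrow> real"
    and xs :: "real^'d" and H :: "real^'d^'d"
    and z0 :: "'m \<Rightarrow> 'w \<Rightarrow> real^'d"
    and A :: "nat \<Rightarrow> 'w \<Rightarrow> real^'m^'m"
    and xbar :: "nat \<Rightarrow> 'w \<Rightarrow> real^'d"
    and L c0 \<epsilon> \<mu> a \<alpha> :: real
  assumes prob: "prob_space M"
    and X_eq: "X = feasible_set B b C c"
    and fj_eq: "fj = agent_objective M F \<xi>"
    and f_eq: "f = total_objective M F \<xi>"
    and xbar_eq: "xbar = primal_mean X F (\<lambda>k. a / real k powr \<alpha>) z0 A \<zeta>"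
    \<comment> \<open>random data\<close>
    and xi_rv: "\<And>j. \<xi> j \<in> measurable M (S j)"
    and z0_rv: "\<And>j. z0 j \<in> borel_measurable M"
    and F_meas: "\<And>j x. F j x \<in> borel_measurable (S j)"
    and F_integrable: "\<And>j x. x \<in> X \<Longrightarrow> integrable M (\<lambda>\<omega>. F j x (\<xi> j \<omega>))"
    \<comment> \<open>the limit point\<close>
    and xs_min: "is_arg_min f (\<lambda>x. x \<in> X) xs"
    and xs_lim: "AE \<omega> in M. (\<lambda>k. xbar k \<omega>) \<longlonglongrightarrow> xs"
    and xs_active: "B *v xs = b"
    and xs_inactive: "\<And>i. (C *v xs) $ i < c $ i"
    \<comment> \<open>objective\<close>
    and F_diff: "\<And>j s x. s \<in> space (S j) \<Longrightarrow> x \<in> X \<Longrightarrow> (\<lambda>y. F j y s) differentiable (at x)"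
    and F_convex: "\<And>j s. s \<in> space (S j) \<Longrightarrow> convex_on X (\<lambda>x. F j x s)"
    and F_lipschitz: "\<And>j s x y. s \<in> space (S j) \<Longrightarrow> x \<in> X \<Longrightarrow> y \<in> X \<Longrightarrow>
          \<bar>F j x s - F j y s\<bar> \<le> L0 j s * norm (x - y)"
    and F_grad_bound: "\<And>j s x. s \<in> space (S j) \<Longrightarrow> x \<in> X \<Longrightarrow>
          norm (gradient (\<lambda>y. F j y s) x) \<le> L0 j s"
    and L0_meas: "\<And>j. L0 j \<in> borel_measurable (S j)"
    and L0_moment: "\<And>j. \<exists>p\<ge>2. integrable M (\<lambda>\<omega>. L0 j (\<xi> j \<omega>) powr p)"
    and fj_diff: "\<And>j x. x \<in> X \<Longrightarrow> fj j differentiable (at x)"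
    and fj_grad: "\<And>j x. x \<in> X \<Longrightarrow>
          gradient (fj j) x = (\<integral>\<omega>. gradient (\<lambda>y. F j y (\<xi> j \<omega>)) x \<partial>M)"
    and L_pos: "0 < L"
    and fj_smooth: "\<And>j x y. x \<in> X \<Longrightarrow> y \<in> X \<Longrightarrow>
          norm (gradient (fj j) x - gradient (fj j) y) \<le> L * norm (x - y)"
    \<comment> \<open>\<open>H\<close> is the Hessian of \<open>f\<close> at \<open>xs\<close>; the derivative relative to \<open>X\<close> already determines \<open>H *v h\<close>
      whenever \<open>B *v h = 0\<close>, because the other constraints are inactive at \<open>xs\<close>\<close>
    and hessian: "(gradient f has_derivative (\<lambda>h. H *v h)) (at xs within X)"
    and c0_pos: "0 < c0" and eps_pos: "0 < \<epsilon>"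
    and hessian_approx: "\<And>x. x \<in> X \<Longrightarrow> norm (x - xs) \<le> \<epsilon> \<Longrightarrow>
          norm (gradient f x - gradient f xs - H *v (x - xs)) \<le> c0 * (norm (x - xs))\<^sup>2"
    and mu_pos: "0 < \<mu>"
    and second_order: "\<And>x. x \<in> critical_tangent_cone B \<Longrightarrow> x \<bullet> (H *v x) \<ge> \<mu> * (norm x)\<^sup>2"
    \<comment> \<open>constraint qualification\<close>
    and cq: "- gradient f xs \<in> rel_interior (active_normal_cone B)"
    \<comment> \<open>weight matrices\<close>
    and A_indep: "prob_space.indep_vars M (\<lambda>_. borel) A {1..}"
    and A_ident: "\<And>k. k \<ge> 1 \<Longrightarrow> distr M borel (A k) = distr M borel (A 1)"
    and A_stoch: "\<And>k. k \<ge> 1 \<Longrightarrow> AE \<omega> in M. doubly_stochastic (A k \<omega>)"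
    and A_contract: "\<And>k. k \<ge> 1 \<Longrightarrow> spectral_norm
          (\<integral>\<omega>. transpose (A k \<omega>) ** (mat 1 - averaging_matrix) ** A k \<omega> \<partial>M) < 1"
    and A_fresh: "\<And>k. k \<ge> 1 \<Longrightarrow>
          prob_space.indep_set M (gen_events M (A k) borel) (sets (history M S z0 A \<zeta> k))"
    \<comment> \<open>step size\<close>
    and alpha: "2 / 3 < \<alpha>" "\<alpha> < 1"
    and a_pos: "0 < a"
    \<comment> \<open>sampling\<close>
    and zeta_indep: "\<And>j. prob_space.indep_vars M (\<lambda>_. S j) (\<zeta> j) {1..}"
    and zeta_distr: "\<And>j k. k \<ge> 1 \<Longrightarrow> distr M (S j) (\<zeta> j k) = distr M (S j) (\<xi> j)"
    and zeta_fresh: "\<And>j k. k \<ge> 1 \<Longrightarrow>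
          prob_space.indep_set M (gen_events M (\<zeta> j k) (S j)) (sets (history M S z0 A \<zeta> k))"
    and zeta_cond_indep: "\<And>i j k. k \<ge> 1 \<Longrightarrow> i \<noteq> j \<Longrightarrow>
          cond_indep_set M (history_weights M S z0 A \<zeta> k)
            (gen_events M (\<zeta> i k) (S i)) (gen_events M (\<zeta> j k) (S j))"
    and zeta_weights: "\<And>j k. k \<ge> 1 \<Longrightarrow>
          cond_indep_set M (history M S z0 A \<zeta> k)
            (gen_events M (\<zeta> j k) (S j)) (gen_events M (A k) borel)"
  shows "AE \<omega> in M. \<exists>K. \<forall>k\<ge>K. B *v xbar k \<omega> = b \<and> (\<forall>i. (C *v xbar k \<omega>) $ i < c $ i)"
proof -
  interpret prob_space M by (rule prob)
  define w where "w = (\<lambda>k. a / real k powr \<alpha>)"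
  define zt where "zt = dual_iter X F w z0 A \<zeta>"
  define zbar where "zbar = dual_mean X F w z0 A \<zeta>"
  \<comment> \<open>Shifted by one: \<open>G t\<close> holds the data up to time \<open>t\<close>,
    so \<open>zt t j\<close> is measurable for \<open>G t\<close> while \<open>A (Suc t)\<close> and
    \<open>\<zeta> j (Suc t)\<close> are each independent of it.\<close>
  define G where "G = (\<lambda>t. history M S z0 A \<zeta> (Suc t))"
  define g where "g = (\<lambda>j x e. gradient (\<lambda>y. F j y e) x)"
  define x where "x = (\<lambda>j t \<omega>. Q_map X (zt (t - 1) j \<omega>))"
  define W where "W = (\<lambda>k. \<Sum>t=1..k. w t)"
  define m where "m = real CARD('m)"
  have m: "m > 0" by (simp add: m_def)
  have xbar: "xbar k \<omega> = Q_map X (zbar (k - 1) \<omega>)" for k \<omega>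
    by (simp add: xbar_eq primal_mean_def zbar_def w_def)
  have X: "convex X" "closed X"
    unfolding X_eq by (rule convex_feasible_set closed_feasible_set)+
  have xsX: "xs \<in> X" using xs_min by (simp add: is_arg_min_def)
  then have "X \<noteq> {}" by auto
  note X = X this
  have Q: "Q_map X v = closest_point X v" for v
    by (rule Q_map_eq_closest_point[OF X])
  have QX: "Q_map X v \<in> X" for v using X closest_point_in_set by (simp add: Q)

  \<comment> \<open>Step sizes\<close>
  have w_nonneg: "0 \<le> w t" for t using a_pos by (simp add: w_def)
  \<comment> \<open>At time 0 the value is \<open>w 0 = 0\<close>, since
    \<open>0 powr \<alpha> = 0\<close> and division by 0 yields 0.\<close>
  have w_le: "w t \<le> a" for t
  proof (cases "t = 0")
    case False
    then have "1 \<le> real t powr \<alpha>" using alpha by (intro ge_one_powr_ge_zero) auto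
    then show ?thesis using a_pos by (simp add: w_def divide_le_eq mult_left_le)
  qed (use a_pos in \<open>simp add: w_def\<close>)
  have w_powr: "w t = a * real t powr (- \<alpha>)" for t
    by (simp add: w_def powr_minus divide_inverse)
  have w2: "summable (\<lambda>t. (w t)\<^sup>2)"
  proof -
    have "(w t)\<^sup>2 = a\<^sup>2 * real t powr (- 2 * \<alpha>)" for t
      by (simp add: w_powr power_mult_distrib power2_eq_square flip: powr_add)
    then show ?thesis
      using alpha by (simp add: summable_mult summable_real_powr_iff)
  qed
  have "\<not> summable w"
    using alpha a_pos unfolding w_powr by (simp add: summable_cmult_iff summable_real_powr_iff)
  then have W: "filterlim W at_top sequentially"
    unfolding W_def by (intro filterlim_sum_at_top w_nonneg)
  then have W_pos: "eventually (\<lambda>k. W k > 0) sequentially"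
    by (simp add: filterlim_at_top_dense)
  have W_inv: "(\<lambda>k. 1 / W k) \<longlonglongrightarrow> 0"
    using tendsto_inverse_0_at_top[OF W] by (simp add: divide_inverse)

  \<comment> \<open>Adaptedness to the history and freshness\<close>
  have A_rv: "A k \<in> borel_measurable M" if "k \<ge> 1" for k
    using A_indep that unfolding indep_vars_def by auto
  have zeta_rv: "\<zeta> j k \<in> measurable M (S j)" if "k \<ge> 1" for j k
    using zeta_indep[of j] that unfolding indep_vars_def by auto
  have G_space: "space (G t) = space M" for t by (simp add: G_def)
  have z0_G: "z0 j \<in> borel_measurable (G t)" for j t
    unfolding G_def
    by (rule measurable_if_gen_events_subset[OF _ gen_events_subset_history(1)]) auto
  have A_G: "A r \<in> borel_measurable (G t)" if "r \<in> {1..t}" for r t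
    unfolding G_def
    by (rule measurable_if_gen_events_subset[OF _ gen_events_subset_history(3)]) (use that in auto)
  have zeta_G: "\<zeta> j r \<in> measurable (G t) (S j)" if "r \<in> {1..t}" for j r t
    unfolding G_def
    by (rule measurable_if_gen_events_subset[OF _ gen_events_subset_history(2)])
       (use that measurable_space[OF zeta_rv] in auto)
  have zt_G: "zt r j \<in> borel_measurable (G t)" if "r \<le> t" for r t j
    unfolding zt_def
    by (rule borel_measurable_dual_iter[OF X F_meas F_diff _ _ _ that])
       (auto intro: z0_G A_G zeta_G)
  have A_fresh': "indep_set (gen_events M (A (Suc t)) borel) (sets (G t))" for t
    unfolding G_def by (rule A_fresh) simp
  have zeta_fresh': "indep_set (gen_events M (\<zeta> j (Suc t)) (S j)) (sets (G t))" for j t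
    unfolding G_def by (rule zeta_fresh) simp
  have G_sub: "sets (G t) \<subseteq> events" for t
    using A_fresh'[of t] unfolding indep_set_def indep_sets_def by (auto simp: UNIV_bool)
  have zt_rv: "zt t j \<in> borel_measurable M" for t j
    using measurable_mono[OF order_refl refl G_sub G_space] zt_G by blast
  have ds: "AE \<omega> in M. \<forall>t. doubly_stochastic (A (Suc t) \<omega>)"
    unfolding AE_all_countable using A_stoch by simp
  have zeta_distr': "distr M (S j) (\<zeta> j (Suc t)) = distr M (S j) (\<xi> j)" for j t
    by (rule zeta_distr) simp

  \<comment> \<open>Second moments of the gradient bounds\<close>
  have L0_nonneg: "0 \<le> L0 j s" if "s \<in> space (S j)" for j s
    using F_grad_bound[OF that xsX] norm_ge_zero order_trans by blast
  have L0_xi: "integrable M (\<lambda>\<omega>. (L0 j (\<xi> j \<omega>))\<^sup>2)" for j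
  proof -
    obtain p where p: "p \<ge> 2" "integrable M (\<lambda>\<omega>. L0 j (\<xi> j \<omega>) powr p)"
      using L0_moment by blast
    show ?thesis
      by (rule square_integrable_if_powr_integrable[OF measurable_compose[OF xi_rv L0_meas] _ p])
         (rule L0_nonneg[OF measurable_space[OF xi_rv]])
  qed
  have L0_zeta: "integrable M (\<lambda>\<omega>. (L0 j (\<zeta> j (Suc t) \<omega>))\<^sup>2)"
    "expectation (\<lambda>\<omega>. (L0 j (\<zeta> j (Suc t) \<omega>))\<^sup>2) = expectation (\<lambda>\<omega>. (L0 j (\<xi> j \<omega>))\<^sup>2)" for j t
  proof -
    note [measurable] = L0_meas[of j] xi_rv[of j] zeta_rv[of "Suc t" j, simplified]
    have "integrable (distr M (S j) (\<zeta> j (Suc t))) (\<lambda>e. (L0 j e)\<^sup>2)"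
      unfolding zeta_distr' using L0_xi[of j] by (subst integrable_distr_eq) auto
    then show "integrable M (\<lambda>\<omega>. (L0 j (\<zeta> j (Suc t) \<omega>))\<^sup>2)"
      by (subst (asm) integrable_distr_eq) auto
    have "(\<integral>e. (L0 j e)\<^sup>2 \<partial>distr M (S j) (\<zeta> j (Suc t))) = (\<integral>e. (L0 j e)\<^sup>2 \<partial>distr M (S j) (\<xi> j))"
      by (simp add: zeta_distr')
    then show "expectation (\<lambda>\<omega>. (L0 j (\<zeta> j (Suc t) \<omega>))\<^sup>2) = expectation (\<lambda>\<omega>. (L0 j (\<xi> j \<omega>))\<^sup>2)"
      by (simp add: integral_distr)
  qed

  \<comment> \<open>Averaging out the sampling noise\<close>
  have noise_i: "AE \<omega> in M. (\<lambda>k. (\<Sum>t=1..k. w t * (g j (x j t \<omega>) (\<zeta> j t \<omega>)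
      - gradient (fj j) (x j t \<omega>)) $ i) / W k) \<longlonglongrightarrow> 0" for j i
  proof -
    \<comment> \<open>The sample is integrated over a separate \<open>\<omega>'\<close> while the
      evaluation point stays fixed at \<open>\<omega>\<close>: this is the mean gradient at a random
      point.\<close>
    have gbar: "gradient (fj j) (x j t \<omega>) = expectation (\<lambda>\<omega>'. g j (x j t \<omega>) (\<xi> j \<omega>'))" for t \<omega>
      using fj_grad[OF QX] by (simp add: x_def g_def)
    show ?thesis
      unfolding gbar unfolding g_def W_def x_def
      by (rule AE_sampling_noise_average[where T = "S j" and l = "L0 j" and a = a and G = G
            and z = "\<lambda>t. zt t j", OF X F_meas F_diff F_grad_bound L0_meas L0_xi xi_rv zeta_distr'
            G_space zt_G zeta_G zeta_rv zeta_fresh' w_nonneg w_le w2 W[unfolded W_def]])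
         simp_all
  qed
  have noise: "AE \<omega> in M. \<forall>j. (\<lambda>k. (1 / W k) *\<^sub>R (\<Sum>t=1..k. w t *\<^sub>R (g j (x j t \<omega>) (\<zeta> j t \<omega>)
      - gradient (fj j) (x j t \<omega>)))) \<longlonglongrightarrow> 0"
  proof -
    have "AE \<omega> in M. \<forall>j i. (\<lambda>k. (\<Sum>t=1..k. w t * (g j (x j t \<omega>) (\<zeta> j t \<omega>)
      - gradient (fj j) (x j t \<omega>)) $ i) / W k) \<longlonglongrightarrow> 0"
      by (intro eventually_all_finite noise_i)
    then show ?thesis
      by eventually_elim (auto intro!: vec_tendstoI)
  qed

  \<comment> \<open>Consensus, coordinate by coordinate\<close>
  have consensus_i: "AE \<omega> in M. (\<lambda>t. centering_matrix *v (\<chi> j. zt t j \<omega> $ i)) \<longlonglongrightarrow> 0" for i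
  proof -
    define \<gamma> where "\<gamma> = (\<lambda>t \<omega>. \<chi> j. g j (x j t \<omega>) (\<zeta> j t \<omega>) $ i)"
    have vec_meas: "(\<lambda>\<omega>. \<chi> j. v j \<omega>) \<in> borel_measurable N"
      if "\<And>j. v j \<in> borel_measurable N" for v :: "'m \<Rightarrow> 'w \<Rightarrow> real" and N
      using that by (subst borel_measurable_euclidean_space) (auto simp: Basis_vec_def inner_axis)
    have nth: "(\<lambda>v::real^'d. v $ i) \<in> borel_measurable borel"
      by (intro borel_measurable_continuous_onI continuous_intros)
    have \<gamma>_meas: "\<gamma> (Suc t) \<in> borel_measurable M" for t
      unfolding \<gamma>_def
    proof (intro vec_meas measurable_compose[OF _ nth])
      fix j
      show "(\<lambda>\<omega>. g j (x j (Suc t) \<omega>) (\<zeta> j (Suc t) \<omega>)) \<in> borel_measurable M"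
        unfolding g_def x_def
        by (rule borel_measurable_gradient[OF F_meas zeta_rv
              measurable_compose[OF zt_rv borel_measurable_Q_map[OF X]]])
           (use measurable_space[OF zeta_rv] QX in \<open>auto intro!: F_diff\<close>)
    qed
    have \<gamma>_le: "(norm (\<gamma> (Suc t) \<omega>))\<^sup>2 \<le> (\<Sum>j\<in>UNIV. (L0 j (\<zeta> j (Suc t) \<omega>))\<^sup>2)"
      if "\<omega> \<in> space M" for t \<omega>
    proof -
      have "(norm (\<gamma> (Suc t) \<omega>))\<^sup>2 = (\<Sum>j\<in>UNIV. (g j (x j (Suc t) \<omega>) (\<zeta> j (Suc t) \<omega>) $ i)\<^sup>2)"
        unfolding power2_norm_eq_inner inner_vec_def \<gamma>_def vec_lambda_beta
        by (simp add: power2_eq_square)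
      also have "\<dots> \<le> (\<Sum>j\<in>UNIV. (L0 j (\<zeta> j (Suc t) \<omega>))\<^sup>2)"
      proof (rule sum_mono)
        fix j
        have "\<bar>g j (x j (Suc t) \<omega>) (\<zeta> j (Suc t) \<omega>) $ i\<bar> \<le> norm (g j (x j (Suc t) \<omega>) (\<zeta> j (Suc t) \<omega>))"
          by (rule component_le_norm_cart)
        also have "\<dots> \<le> L0 j (\<zeta> j (Suc t) \<omega>)"
          unfolding g_def x_def using measurable_space[OF zeta_rv that] QX by (intro F_grad_bound) auto
        finally show "(g j (x j (Suc t) \<omega>) (\<zeta> j (Suc t) \<omega>) $ i)\<^sup>2 \<le> (L0 j (\<zeta> j (Suc t) \<omega>))\<^sup>2"
          by (metis abs_ge_zero power2_abs power_mono)
      qed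
      finally show ?thesis .
    qed
    have \<gamma>_int: "integrable M (\<lambda>\<omega>. (norm (\<gamma> (Suc t) \<omega>))\<^sup>2)" for t
    proof (rule Bochner_Integration.integrable_bound)
      show "integrable M (\<lambda>\<omega>. \<Sum>j\<in>UNIV. (L0 j (\<zeta> j (Suc t) \<omega>))\<^sup>2)" using L0_zeta(1) by simp
      show "(\<lambda>\<omega>. (norm (\<gamma> (Suc t) \<omega>))\<^sup>2) \<in> borel_measurable M" using \<gamma>_meas[of t] by measurable
      show "AE \<omega> in M. norm ((norm (\<gamma> (Suc t) \<omega>))\<^sup>2)
          \<le> norm (\<Sum>j\<in>UNIV. (L0 j (\<zeta> j (Suc t) \<omega>))\<^sup>2)"
        using \<gamma>_le by (intro AE_I2) (simp add: sum_nonneg)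
    qed
    have \<gamma>_V: "expectation (\<lambda>\<omega>. (norm (\<gamma> (Suc t) \<omega>))\<^sup>2)
        \<le> (\<Sum>j\<in>UNIV. expectation (\<lambda>\<omega>. (L0 j (\<xi> j \<omega>))\<^sup>2))" for t
    proof -
      have "expectation (\<lambda>\<omega>. (norm (\<gamma> (Suc t) \<omega>))\<^sup>2)
          \<le> expectation (\<lambda>\<omega>. \<Sum>j\<in>UNIV. (L0 j (\<zeta> j (Suc t) \<omega>))\<^sup>2)"
        using L0_zeta(1) by (intro integral_mono \<gamma>_int \<gamma>_le) auto
      also have "\<dots> = (\<Sum>j\<in>UNIV. expectation (\<lambda>\<omega>. (L0 j (\<xi> j \<omega>))\<^sup>2))"
        using L0_zeta by simp
      finally show ?thesis .
    qed
    \<comment> \<open>For a fixed coordinate \<open>i\<close> the weights act on the vector of all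
      agents' values by plain matrix multiplication, the form that \<open>AE_consensus\<close>
      expects.\<close>
    have rec: "(\<chi> j. zt (Suc t) j \<omega> $ i)
        = A (Suc t) \<omega> *v (\<chi> j. zt t j \<omega> $ i) - w (Suc t) *\<^sub>R \<gamma> (Suc t) \<omega>" for t \<omega>
      by (simp add: vec_eq_iff zt_def \<gamma>_def g_def x_def matrix_vector_mult_def)
    let ?gram = "\<lambda>U :: real^'m^'m. transpose U ** centering_matrix ** U"
    \<comment> \<open>Identical distribution makes the expected Gram matrix the same at all times,
      so its norm at time 1 serves as a uniform contraction constant.\<close>
    have gram_eq: "expectation (\<lambda>\<omega>. ?gram (A (Suc t) \<omega>)) = expectation (\<lambda>\<omega>. ?gram (A 1 \<omega>))" for t
    proof -
      have [measurable]: "?gram \<in> borel_measurable borel"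
        by (rule borel_measurable_continuous_onI[OF continuous_on_gram])
      have "integral\<^sup>L (distr M borel (A (Suc t))) ?gram = integral\<^sup>L (distr M borel (A 1)) ?gram"
        using A_ident[of "Suc t"] by simp
      then show ?thesis
        using A_rv[of "Suc t"] A_rv[of 1] by (simp add: integral_distr)
    qed
    show ?thesis
    proof (rule AE_consensus[where G = G and W = A and \<gamma> = \<gamma> and s = w])
      show "(\<lambda>\<omega>. \<chi> j. zt t j \<omega> $ i) \<in> borel_measurable (G t)" for t
        by (intro vec_meas measurable_compose[OF _ nth] zt_G) simp
      show "(\<lambda>\<omega>. \<chi> j. zt 0 j \<omega> $ i) \<in> borel_measurable (G t)" for t
        by (intro vec_meas measurable_compose[OF _ nth] zt_G) simp
      show "spectral_norm (expectation (\<lambda>\<omega>. ?gram (A 1 \<omega>))) < 1" using A_contract[of 1] by simp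
      show "spectral_norm (expectation (\<lambda>\<omega>. ?gram (A (Suc t) \<omega>)))
          \<le> spectral_norm (expectation (\<lambda>\<omega>. ?gram (A 1 \<omega>)))" for t
        by (simp only: gram_eq order_refl)
      show "summable (\<lambda>t. (w (Suc t))\<^sup>2)" using w2 by (subst summable_Suc_iff)
    qed (use G_space A_rv A_fresh' A_stoch rec \<gamma>_meas \<gamma>_int \<gamma>_V in auto)
  qed
  have consensus: "AE \<omega> in M. \<forall>j. (\<lambda>t. zt t j \<omega> - zbar t \<omega>) \<longlonglongrightarrow> 0"
  proof -
    have "AE \<omega> in M. \<forall>i. (\<lambda>t. centering_matrix *v (\<chi> j. zt t j \<omega> $ i)) \<longlonglongrightarrow> 0"
      by (intro eventually_all_finite consensus_i)
    then show ?thesis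
    proof eventually_elim
      case (elim \<omega>)
      have "(\<lambda>t. (zt t j \<omega> - zbar t \<omega>) $ i) \<longlonglongrightarrow> 0 $ i" for j i
        using tendsto_vec_nth[OF elim[rule_format, of i], of j]
        by (simp add: centering_matrix_mult zbar_def dual_mean_def zt_def)
      then show ?case by (intro allI vec_tendstoI)
    qed
  qed

  \<comment> \<open>Gradient of the total objective at the limit point\<close>
  have grad_f: "gradient f xs = (\<Sum>j\<in>UNIV. gradient (fj j) xs)"
  proof (rule gradient_eqI)
    have "f = (\<lambda>y. \<Sum>j\<in>UNIV. fj j y)"
      by (simp add: f_eq fj_eq total_objective_def fun_eq_iff)
    moreover have "((\<lambda>y. \<Sum>j\<in>UNIV. fj j y) has_derivative
        (\<lambda>h. \<Sum>j\<in>UNIV. h \<bullet> gradient (fj j) xs)) (at xs)"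
      using gderiv_gradient[OF fj_diff[OF xsX]] unfolding gderiv_def
      by (intro has_derivative_sum) auto
    ultimately show "GDERIV f xs :> (\<Sum>j\<in>UNIV. gradient (fj j) xs)"
      by (simp add: gderiv_def inner_sum_right)
  qed

  \<comment> \<open>Deterministic argument along almost every path\<close>
  show ?thesis
    using ds noise consensus xs_lim
  proof eventually_elim
    case (elim \<omega>)
    have xbar_Suc: "(\<lambda>k. xbar (Suc k) \<omega>) \<longlonglongrightarrow> xs"
      using elim(4) by (rule LIMSEQ_Suc)
    have x_lim: "(\<lambda>t. x j t \<omega>) \<longlonglongrightarrow> xs" for j
    proof -
      have "(\<lambda>t. x j (Suc t) \<omega> - xbar (Suc t) \<omega>) \<longlonglongrightarrow> 0"
      proof (rule Lim_null_comparison)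
        show "eventually (\<lambda>t. norm (x j (Suc t) \<omega> - xbar (Suc t) \<omega>) \<le> norm (zt t j \<omega> - zbar t \<omega>))
            sequentially"
          using closest_point_lipschitz[OF X] by (simp add: x_def xbar Q dist_norm)
        show "(\<lambda>t. norm (zt t j \<omega> - zbar t \<omega>)) \<longlonglongrightarrow> 0"
          using elim(3) by (simp add: tendsto_norm_zero)
      qed
      from tendsto_add[OF this xbar_Suc] have "(\<lambda>t. x j (Suc t) \<omega>) \<longlonglongrightarrow> xs" by simp
      then show ?thesis by (rule LIMSEQ_imp_Suc)
    qed
    have grad_lim: "(\<lambda>t. gradient (fj j) (x j t \<omega>)) \<longlonglongrightarrow> gradient (fj j) xs" for j
    proof (rule LIM_zero_cancel, rule Lim_null_comparison)
      show "eventually (\<lambda>t. norm (gradient (fj j) (x j t \<omega>) - gradient (fj j) xs)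
          \<le> L * norm (x j t \<omega> - xs)) sequentially"
        using fj_smooth[OF QX xsX] by (simp add: x_def)
      show "(\<lambda>t. L * norm (x j t \<omega> - xs)) \<longlonglongrightarrow> 0"
        using tendsto_mult_right_zero[OF tendsto_norm_zero[OF LIM_zero[OF x_lim]]] .
    qed
    have avg: "(\<lambda>k. (1 / W k) *\<^sub>R (\<Sum>t=1..k. w t *\<^sub>R g j (x j t \<omega>) (\<zeta> j t \<omega>)))
        \<longlonglongrightarrow> gradient (fj j) xs" for j
    proof -
      have "(\<lambda>k. (1 / W k) *\<^sub>R (\<Sum>t=1..k. w t *\<^sub>R gradient (fj j) (x j t \<omega>)))
          \<longlonglongrightarrow> gradient (fj j) xs"
        using weighted_average_tendsto[OF w_nonneg W[unfolded W_def] grad_lim[of j]]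
        by (simp add: W_def)
      from tendsto_add[OF elim(2)[rule_format, of j] this] show ?thesis
        by (simp add: scaleR_right_diff_distrib sum_subtractf)
    qed
    have zbar_Suc: "zbar (Suc k) \<omega>
        = zbar k \<omega> - (1 / m) *\<^sub>R (\<Sum>j\<in>UNIV. w (Suc k) *\<^sub>R g j (x j (Suc k) \<omega>) (\<zeta> j (Suc k) \<omega>))" for k
    proof -
      \<comment> \<open>Swapping the sums produces the column sums of the weight matrix, all equal
        to 1: mixing preserves the mean.\<close>
      have "(\<Sum>j\<in>UNIV. \<Sum>i\<in>UNIV. A (Suc k) \<omega> $ j $ i *\<^sub>R zt k i \<omega>)
          = (\<Sum>i\<in>UNIV. (\<Sum>j\<in>UNIV. A (Suc k) \<omega> $ j $ i) *\<^sub>R zt k i \<omega>)"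
        by (subst sum.swap) (simp add: scaleR_left.sum)
      also have "\<dots> = (\<Sum>i\<in>UNIV. zt k i \<omega>)"
        using elim(1) by (simp add: doubly_stochastic_def)
      finally show ?thesis
        by (simp add: zbar_def dual_mean_def zt_def x_def g_def m_def sum_subtractf
            scaleR_right_diff_distrib)
    qed
    have zbar_sum: "zbar k \<omega> = zbar 0 \<omega>
        - (1 / m) *\<^sub>R (\<Sum>j\<in>UNIV. \<Sum>t=1..k. w t *\<^sub>R g j (x j t \<omega>) (\<zeta> j t \<omega>))" for k
      by (induction k) (simp_all add: zbar_Suc sum.distrib scaleR_right_distrib)
    \<comment> \<open>The scale \<open>m / W k\<close> cancels the \<open>1 / m\<close> of the mean.
      Under it the initial value and the convergent projected points vanish, leaving the averaged
      gradients.\<close>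
    have "(\<lambda>k. (m * (1 / W k)) *\<^sub>R (zbar 0 \<omega> - xbar (Suc k) \<omega>)
        - (\<Sum>j\<in>UNIV. (1 / W k) *\<^sub>R (\<Sum>t=1..k. w t *\<^sub>R g j (x j t \<omega>) (\<zeta> j t \<omega>))))
        \<longlonglongrightarrow> (m * 0) *\<^sub>R (zbar 0 \<omega> - xs) - (\<Sum>j\<in>UNIV. gradient (fj j) xs)"
      by (intro tendsto_intros W_inv xbar_Suc avg)
    moreover have "(m * (1 / W k)) *\<^sub>R (zbar 0 \<omega> - xbar (Suc k) \<omega>)
        - (\<Sum>j\<in>UNIV. (1 / W k) *\<^sub>R (\<Sum>t=1..k. w t *\<^sub>R g j (x j t \<omega>) (\<zeta> j t \<omega>)))
        = (1 / (W k / m)) *\<^sub>R (zbar k \<omega> - closest_point X (zbar k \<omega>))" for k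
    proof -
      have "(m * (1 / W k)) *\<^sub>R (u - p) - (\<Sum>j\<in>UNIV. (1 / W k) *\<^sub>R s j)
          = (1 / (W k / m)) *\<^sub>R (u - (1 / m) *\<^sub>R (\<Sum>j\<in>UNIV. s j) - p)"
        for u p :: "real^'d" and s :: "'m \<Rightarrow> real^'d"
        using m by (simp add: scaleR_right_diff_distrib flip: scaleR_right.sum)
      then show ?thesis by (simp only: xbar Q diff_Suc_1 flip: zbar_sum)
    qed
    ultimately have lim: "(\<lambda>k. (1 / (W k / m)) *\<^sub>R (zbar k \<omega> - closest_point X (zbar k \<omega>)))
        \<longlonglongrightarrow> - gradient f xs"
      by (simp add: grad_f)
    have slack: "eventually (\<lambda>k. \<forall>i. (C *v xbar k \<omega>) $ i < c $ i) sequentially"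
    proof (intro eventually_all_finite allI)
      fix i
      have "(\<lambda>k. (C *v xbar k \<omega>) $ i) \<longlonglongrightarrow> (C *v xs) $ i"
        by (intro tendsto_vec_nth bounded_linear.tendsto[OF matrix_vector_mul_bounded_linear] elim(4))
      then show "eventually (\<lambda>k. (C *v xbar k \<omega>) $ i < c $ i) sequentially"
        using xs_inactive[of i] by (rule order_tendstoD(2))
    qed
    \<comment> \<open>\<open>xbar (Suc k)\<close> is the projection of \<open>zbar k\<close>, so
      statements about \<open>xbar\<close> are shifted by one before the projection lemma applies
      and shifted back afterwards.\<close>
    have slack': "eventually (\<lambda>k. \<forall>i. (C *v closest_point X (zbar k \<omega>)) $ i < c $ i) sequentially"
      using eventually_sequentially_Suc[THEN iffD2, OF slack] by (simp add: xbar Q)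
    have "eventually (\<lambda>k. W k / m > 0) sequentially"
      using W_pos by eventually_elim (use m in simp)
    from eventually_projection_active[of B b C c xs "\<lambda>k. zbar k \<omega>", folded X_eq,
        OF X(1,2) xsX xs_active slack' this lim cq]
    have "eventually (\<lambda>k. B *v xbar (Suc k) \<omega> = b) sequentially"
      by (simp add: xbar Q)
    then have "eventually (\<lambda>k. B *v xbar k \<omega> = b) sequentially"
      by (rule eventually_sequentially_Suc[THEN iffD1])
    with slack have "eventually (\<lambda>k. B *v xbar k \<omega> = b \<and> (\<forall>i. (C *v xbar k \<omega>) $ i < c $ i)) sequentially"
      by (rule eventually_conj[rotated])
    then show ?case by (simp add: eventually_sequentially)
  qed
qed

end
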